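(* Let $\mathbb K$ be $\mathbb R$ or $\mathbb C$, and let $\mathbf P^n=\mathbb{KP}^n$. Let $X$ be a smooth closed connected sub-manifold of $\mathbf P^n$ of positive real dimension and positive real codimension. Assume that $X\cap\mathbf H_\infty$ is not empty and is a transverse intersection. Then the affine part $X^a=X\setminus\mathbf H_\infty$, viewed as a subset of $\mathbb K^n$, is conic at $\infty$.
   Context: Smooth means $C^\infty$. The affine space $\mathbb K^n$ is embedded in $\mathbf P^n$ by $x\mapsto[x:1]$, and $\mathbf H_\infty=\mathbf P^n\setminus\mathbb K^n=\{[y:0]:y\in\mathbb K^n\setminus 0\}$ is the hyperplane at infinity. Transversality means: $T_xX+T_x\mathbf H_\infty=T_x\mathbf P^n$ (as real vector spaces) at each $x\in X\cap\mathbf H_\infty$. Put $m=\dim_{\mathbb R}\mathbb K^n$, and identify $\mathbb K^n$ with $\mathbb R^m$ (for $\mathbb K=\mathbb C$ by taking real and imaginary parts of the coordinates, $m=2n$). **p-sub-manifolds.** A subset $N$ of a smooth manifold with boundary $(P,\partial P)$ is a p-sub-manifold of $P$ if it is a smooth embedded sub-manifold with (possibly empty) boundary $\partial N$, with $\partial N=N\cap\partial P$, and $T_xN+T_x\partial P=T_xP$ for every $x\in\partial N$. **Conic at infinity.** Let $\overline{\mathbf M}=[0,\infty)\times\mathbb S^{m-1}$ and let $\beta:(0,\infty)\times\mathbb S^{m-1}\to\mathbb R^m\setminus 0$, $\beta(r,u)=u/r$. The space $\overline{\mathbb R^m}$ is the compactification of $\mathbb R^m$ as a manifold with boundary obtained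 by identifying $\mathbb R^m\setminus 0$ with the interior of $\overline{\mathbf M}$ via $\beta$; its boundary is $0\times\mathbb S^{m-1}$. For $Y\subset\mathbb R^m$, let $\overline Y$ be its closure in $\overline{\mathbb R^m}$ and let $0\times Y^\infty=\overline Y\cap(0\times\mathbb S^{m-1})$. The set $Y$ is conic at $\infty$ if either $Y$ is bounded, or the germ of $\overline Y$ along $0\times Y^\infty$ is non-empty and is the germ of a smooth p-sub-manifold of $\overline{\mathbb R^m}$. *)

theory Defs
  imports "HOL-Analysis.Analysis"
begin

section \<open>Smooth maps and sub-manifolds of a Euclidean space\<close>

text \<open>Both notions below are meant for an open set \<open>S\<close>; a smooth map is a \<open>C\<^sup>\<infinity>\<close> map.\<close>

primrec Ck_on :: "nat \<Rightarrow> ('a::real_normed_vector \<Rightarrow> 'b::real_normed_vector) \<Rightarrow> 'a set \<Rightarrow> bool" where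
  "Ck_on 0 = (\<lambda>f S. continuous_on S f)"
| "Ck_on (Suc k) = (\<lambda>f S. (\<forall>x\<in>S. f differentiable (at x)) \<and>
     (\<forall>v. Ck_on k (\<lambda>x. frechet_derivative f (at x) v) S))"

definition smooth_on :: "'a::real_normed_vector set \<Rightarrow> ('a \<Rightarrow> 'b::real_normed_vector) \<Rightarrow> bool" where
  "smooth_on S f \<longleftrightarrow> (\<forall>k. Ck_on k f S)"

text \<open>A slice chart \<open>\<Phi>\<close>, defined on \<open>U\<close>, straightens \<open>N\<close> to an open piece of the subspace \<open>L\<close>
  (case \<open>b = 0\<close>) or of the closed half-space of \<open>L\<close> with inner normal \<open>b \<noteq> 0\<close>.\<close>

definition slice_chart ::
  "'e::euclidean_space set \<Rightarrow> ('e \<Rightarrow> 'e) \<Rightarrow> 'e set \<Rightarrow> 'e set \<Rightarrow> 'e \<Rightarrow> bool" where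
  "slice_chart U \<Phi> N L b \<longleftrightarrow>
     open U \<and> open (\<Phi> ` U) \<and> inj_on \<Phi> U \<and>
     smooth_on U \<Phi> \<and> smooth_on (\<Phi> ` U) (inv_into U \<Phi>) \<and>
     subspace L \<and> b \<in> L \<and>
     \<Phi> ` (N \<inter> U) = \<Phi> ` U \<inter> {v \<in> L. 0 \<le> b \<bullet> v}"

text \<open>Smooth embedded sub-manifolds, possibly with boundary, of dimension \<open>k\<close>.\<close>

definition euclidean_submanifold :: "nat \<Rightarrow> 'e::euclidean_space set \<Rightarrow> bool" where
  "euclidean_submanifold k N \<longleftrightarrow>
     (\<forall>x\<in>N. \<exists>U \<Phi> L b. x \<in> U \<and> slice_chart U \<Phi> N L b \<and> dim L = k)"

definition euclidean_boundary :: "'e::euclidean_space set \<Rightarrow> 'e set" where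
  "euclidean_boundary N =
     {x \<in> N. \<exists>U \<Phi> L b. x \<in> U \<and> slice_chart U \<Phi> N L b \<and> b \<noteq> 0 \<and> b \<bullet> \<Phi> x = 0}"

text \<open>The tangent space is spanned by the velocities at time \<open>0\<close> of the smooth curves
  \<open>[0, \<epsilon>) \<rightarrow> N\<close> starting at \<open>x\<close>. Curves are one-sided, and the span is taken, because
  \<open>x\<close> may be a boundary point, where these velocities only fill a half-space.\<close>

definition euclidean_tangent :: "'e::euclidean_space set \<Rightarrow> 'e \<Rightarrow> 'e set" where
  "euclidean_tangent N x = span {v. \<exists>\<gamma> e. 0 < e \<and> smooth_on {-e<..<e} \<gamma> \<and> \<gamma> 0 = x \<and>
     \<gamma> ` {0..<e} \<subseteq> N \<and> (\<gamma> has_vector_derivative v) (at (0::real))}"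

section \<open>Manifolds with boundary, given by an atlas\<close>

text \<open>A chart is a pair \<open>(U, \<phi>)\<close> where \<open>\<phi>\<close> maps \<open>U\<close> injectively onto a relatively open
  subset of the model space \<open>'e\<close> or of a closed half-space of it. Such a subset is itself a
  sub-manifold with boundary of \<open>'e\<close>, and so sub-manifolds of the manifold, their
  boundaries and their tangent spaces are described in charts by the notions above.
  In particular the boundary of the manifold itself is \<open>mfd_boundary A (mfd_carrier A)\<close>.\<close>

type_synonym ('p, 'e) atlas = "('p set \<times> ('p \<Rightarrow> 'e)) set"

definition mfd_carrier :: "('p, 'e) atlas \<Rightarrow> 'p set" where
  "mfd_carrier A = (\<Union>(U, \<phi>)\<in>A. U)"

definition mfd_topology :: "('p, 'e::euclidean_space) atlas \<Rightarrow> 'p topology" where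
  "mfd_topology A = topology (\<lambda>S. S \<subseteq> mfd_carrier A \<and>
     (\<forall>(U, \<phi>)\<in>A. openin (pullback_topology U \<phi> euclidean) (S \<inter> U)))"

lemma openin_mfd_topology:
  "openin (mfd_topology A) S \<longleftrightarrow> S \<subseteq> mfd_carrier A \<and>
     (\<forall>(U, \<phi>)\<in>A. openin (pullback_topology U \<phi> euclidean) (S \<inter> U))"
proof -
  define opn where "opn S \<longleftrightarrow> S \<subseteq> mfd_carrier A \<and>
     (\<forall>(U, \<phi>)\<in>A. openin (pullback_topology U \<phi> euclidean) (S \<inter> U))" for S
  have "opn (S \<inter> T)" if S: "opn S" and T: "opn T" for S T
  proof -
    have "openin (pullback_topology U \<phi> euclidean) (S \<inter> T \<inter> U)" if "(U, \<phi>) \<in> A" for U \<phi>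
    proof -
      have "openin (pullback_topology U \<phi> euclidean) ((S \<inter> U) \<inter> (T \<inter> U))"
        using S T that unfolding opn_def by (blast intro: openin_Int)
      moreover have "(S \<inter> U) \<inter> (T \<inter> U) = S \<inter> T \<inter> U" by blast
      ultimately show ?thesis by simp
    qed
    then show ?thesis using S unfolding opn_def by auto
  qed
  moreover have "opn (\<Union>\<K>)" if K: "\<And>K. K \<in> \<K> \<Longrightarrow> opn K" for \<K>
  proof -
    have "openin (pullback_topology U \<phi> euclidean) (\<Union>\<K> \<inter> U)" if "(U, \<phi>) \<in> A" for U \<phi>
    proof -
      have "openin (pullback_topology U \<phi> euclidean) (\<Union>((\<lambda>K. K \<inter> U) ` \<K>))"
        using K that unfolding opn_def by (intro openin_Union) fast
      moreover have "\<Union>((\<lambda>K. K \<inter> U) ` \<K>) = \<Union>\<K> \<inter> U" by blast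
      ultimately show ?thesis by simp
    qed
    then show ?thesis using K unfolding opn_def by auto
  qed
  ultimately have "istopology opn" unfolding istopology_def by blast
  moreover have "mfd_topology A = topology opn"
    unfolding mfd_topology_def opn_def ..
  ultimately show ?thesis by (simp add: topology_inverse' opn_def)
qed

definition submanifold :: "('p, 'e::euclidean_space) atlas \<Rightarrow> nat \<Rightarrow> 'p set \<Rightarrow> bool" where
  "submanifold A k N \<longleftrightarrow> N \<subseteq> mfd_carrier A \<and>
     (\<forall>(U, \<phi>)\<in>A. euclidean_submanifold k (\<phi> ` (N \<inter> U)))"

definition mfd_boundary :: "('p, 'e::euclidean_space) atlas \<Rightarrow> 'p set \<Rightarrow> 'p set" where
  "mfd_boundary A N = {x \<in> N. \<exists>(U, \<phi>)\<in>A. x \<in> U \<and> \<phi> x \<in> euclidean_boundary (\<phi> ` (N \<inter> U))}"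

text \<open>The tangent space of \<open>N\<close> at \<open>x\<close>, read in a chart around \<open>x\<close>.\<close>

definition tangent_in :: "'p set \<times> ('p \<Rightarrow> 'e::euclidean_space) \<Rightarrow> 'p set \<Rightarrow> 'p \<Rightarrow> 'e set" where
  "tangent_in c N x = euclidean_tangent (snd c ` (N \<inter> fst c)) (snd c x)"

text \<open>\<open>T\<^sub>x M + T\<^sub>x N = T\<^sub>x P\<close>, where \<open>P\<close> is the ambient manifold. The sum is that of sets of vectors.\<close>

definition transverse_at ::
  "('p, 'e::euclidean_space) atlas \<Rightarrow> 'p set \<Rightarrow> 'p set \<Rightarrow> 'p \<Rightarrow> bool" where
  "transverse_at A M N x \<longleftrightarrow> (\<forall>c\<in>A. x \<in> fst c \<longrightarrow>
     tangent_in c M x + tangent_in c N x = tangent_in c (mfd_carrier A) x)"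

definition p_submanifold :: "('p, 'e::euclidean_space) atlas \<Rightarrow> 'p set \<Rightarrow> bool" where
  "p_submanifold A N \<longleftrightarrow> (\<exists>k. submanifold A k N) \<and>
     mfd_boundary A N = N \<inter> mfd_boundary A (mfd_carrier A) \<and>
     (\<forall>x\<in>mfd_boundary A N. transverse_at A N (mfd_boundary A (mfd_carrier A)) x)"

section \<open>Projective space\<close>

text \<open>The field \<open>'k\<close> will be \<open>real\<close> or \<open>complex\<close>. Homogeneous coordinates are taken in
  \<open>('k ^ 'n) \<times> 'k\<close>, and the point \<open>[x : t]\<close> is the line through \<open>(x, t)\<close> (which includes the
  zero vector).\<close>

type_synonym ('k, 'n) hline = "(('k ^ 'n) \<times> 'k) set"

definition hpoint :: "'k::{real_normed_field,euclidean_space} ^ 'n::finite \<Rightarrow> 'k \<Rightarrow> ('k, 'n) hline" where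
  "hpoint x t = range (\<lambda>c. (c *s x, c * t))"

definition proj_space :: "('k::{real_normed_field,euclidean_space}, 'n::finite) hline set" where
  "proj_space = {hpoint x t | x t. (x, t) \<noteq> (0, 0)}"

definition hyperplane_at_infinity ::
    "('k::{real_normed_field,euclidean_space}, 'n::finite) hline set" where
  "hyperplane_at_infinity =
     proj_space - range (\<lambda>x. hpoint x 1)"

text \<open>The standard affine charts, as inverses of parametrizations: \<open>x \<mapsto> [x : 1]\<close>, and for
  each \<open>i\<close> the map inserting \<open>1\<close> in slot \<open>i\<close> of \<open>x\<close> and moving \<open>x $ i\<close> to the last slot.\<close>

definition proj_param ::
    "'n \<Rightarrow> 'k::{real_normed_field,euclidean_space} ^ 'n \<Rightarrow> ('k, 'n::finite) hline" where
  "proj_param i x = hpoint (\<chi> j. if j = i then 1 else x $ j) (x $ i)"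

definition proj_atlas ::
    "(('k::{real_normed_field,euclidean_space}, 'n::finite) hline, 'k ^ 'n) atlas" where
  "proj_atlas = insert (range (\<lambda>x. hpoint x 1), inv (\<lambda>x. hpoint x 1))
     (range (\<lambda>i. (range (proj_param i), inv (proj_param i))))"

lemma hpoint_scale:
  assumes "c \<noteq> 0" shows "hpoint (c *s x) (c * t) = hpoint x t"
proof -
  have "hpoint (c *s x) (c * t) = (\<lambda>d. (d *s x, d * t)) ` range (\<lambda>d. d * c)"
    unfolding hpoint_def by (simp only: image_image vector_smult_assoc mult.assoc)
  moreover have "range (\<lambda>d. d * c) = UNIV"
    using assms by (intro surjI[where f = "\<lambda>d. d / c"]) simp
  ultimately show ?thesis by (simp add: hpoint_def)
qed

lemma mfd_carrier_proj_atlas: "mfd_carrier proj_atlas =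
    (proj_space :: ('k::{real_normed_field,euclidean_space}, 'n::finite) hline set)"
proof
  have "hpoint x 1 \<in> proj_space" for x :: "'k ^ 'n"
    unfolding proj_space_def by (intro CollectI exI[of _ x] exI[of _ 1]) simp
  moreover have "proj_param i x \<in> proj_space" for i and x :: "'k ^ 'n"
  proof -
    have "(\<chi> j. if j = i then 1 else x $ j) \<noteq> 0" (is "?y \<noteq> 0")
    proof
      assume "?y = 0"
      then have "?y $ i = 0" by (simp only: zero_index)
      then show False by simp
    qed
    then show ?thesis unfolding proj_space_def proj_param_def
      by (intro CollectI exI[of _ ?y] exI[of _ "x $ i"]) simp
  qed
  ultimately show "mfd_carrier (proj_atlas :: (('k, 'n) hline, 'k ^ 'n) atlas) \<subseteq> proj_space"
    unfolding mfd_carrier_def proj_atlas_def by auto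
next
  show "(proj_space :: ('k, 'n) hline set) \<subseteq> mfd_carrier proj_atlas"
  proof
    fix l :: "('k, 'n) hline" assume "l \<in> proj_space"
    then obtain x t where l: "l = hpoint x t" and nz: "(x, t) \<noteq> (0, 0)"
      unfolding proj_space_def by blast
    show "l \<in> mfd_carrier proj_atlas"
    proof (cases "t = 0")
      case False
      then have "l = hpoint (inverse t *s x) 1"
        using hpoint_scale[of "inverse t" x t] by (simp add: l)
      then show ?thesis unfolding mfd_carrier_def proj_atlas_def by auto
    next
      case True
      then obtain i where i: "x $ i \<noteq> 0" using nz by (auto simp: vec_eq_iff)
      define y where "y = (\<chi> j. if j = i then t / x $ i else x $ j / x $ i)"
      have "(\<chi> j. if j = i then 1 else y $ j) = inverse (x $ i) *s x"
        using i by (auto simp: y_def vec_eq_iff field_simps)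
      moreover have "y $ i = inverse (x $ i) * t" by (simp add: y_def field_simps)
      ultimately have "l = proj_param i y"
        using hpoint_scale[of "inverse (x $ i)" x t] i by (simp only: l proj_param_def) simp
      then show ?thesis unfolding mfd_carrier_def proj_atlas_def by auto
    qed
  qed
qed

lemma hyperplane_at_infinity_eq:
  "hyperplane_at_infinity =
     {hpoint y 0 | y. y \<noteq> (0 :: 'k::{real_normed_field,euclidean_space} ^ 'n::finite)}"
proof -
  have "l \<in> {hpoint y 0 | y. y \<noteq> 0}" if l: "l \<in> hyperplane_at_infinity" for l :: "('k, 'n) hline"
  proof -
    obtain x t where xt: "l = hpoint x t" "(x, t) \<noteq> (0, 0)"
      using l unfolding hyperplane_at_infinity_def proj_space_def by blast
    have "t = 0"
    proof (rule ccontr)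
      assume "t \<noteq> 0"
      then have "l = hpoint (inverse t *s x) 1"
        using hpoint_scale[of "inverse t" x t] by (simp add: xt)
      then show False using l unfolding hyperplane_at_infinity_def by blast
    qed
    then show ?thesis using xt by auto
  qed
  moreover have "hpoint y 0 \<in> hyperplane_at_infinity" if "y \<noteq> 0" for y :: "'k ^ 'n"
  proof -
    have "hpoint y 0 \<noteq> hpoint x 1" for x :: "'k ^ 'n"
    proof
      assume eq: "hpoint y 0 = hpoint x 1"
      have "(x, 1) \<in> hpoint x 1" unfolding hpoint_def by (rule range_eqI[of _ _ 1]) simp
      then show False unfolding eq[symmetric] by (auto simp: hpoint_def)
    qed
    then show ?thesis using that unfolding hyperplane_at_infinity_def proj_space_def by blast
  qed
  ultimately show ?thesis by blast
qed

section \<open>The radial compactification of a Euclidean space\<close>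

text \<open>Gluing \<open>[0, \<infinity>) \<times> S\<close> (\<open>S\<close> the unit sphere) to the Euclidean space along \<open>(r, u) \<mapsto> u / r\<close>, \<open>r > 0\<close>:
  the points are the \<open>Fin x\<close>, and the boundary points \<open>Bdry u\<close>, standing for \<open>(0, u)\<close>,
  with \<open>u \<in> S\<close>.\<close>

datatype 'a radial = Fin 'a | Bdry 'a

definition radial_collar :: "real \<Rightarrow> 'a::euclidean_space \<Rightarrow> 'a radial" where
  "radial_collar r u = (if r = 0 then Bdry u else Fin (u /\<^sub>R r))"

text \<open>The parametrization of \<open>[0, \<infinity>) \<times> S\<close> associated with a unit vector \<open>e\<close> writes a vector of the
  half-space \<open>{v. 0 \<le> e \<bullet> v}\<close> as \<open>v = r e + w\<close> with \<open>w\<close> orthogonal to \<open>e\<close>, and sends it to the pair of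
  \<open>r\<close> and the point \<open>(e + w) / |e + w|\<close> of the open hemisphere centred at \<open>e\<close> (central
  projection).\<close>

definition radial_param :: "'a::euclidean_space \<Rightarrow> 'a \<Rightarrow> 'a radial" where
  "radial_param e v = radial_collar (e \<bullet> v) (sgn (e + (v - (e \<bullet> v) *\<^sub>R e)))"

definition radial_atlas :: "('a::euclidean_space radial, 'a) atlas" where
  "radial_atlas = insert (range Fin, inv Fin)
     ((\<lambda>e. (radial_param e ` {v. 0 \<le> e \<bullet> v}, inv_into {v. 0 \<le> e \<bullet> v} (radial_param e))) ` sphere 0 1)"

text \<open>The underlying set and the boundary of the compactification are the expected ones.\<close>

lemma radial_param_inj:
  fixes e :: "'a::euclidean_space"
  assumes e: "e \<in> sphere 0 1"
  shows "inj_on (radial_param e) {v. 0 \<le> e \<bullet> v}"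
proof (rule inj_onI)
  fix v v' assume v: "v \<in> {v. 0 \<le> e \<bullet> v}" "v' \<in> {v. 0 \<le> e \<bullet> v}"
    and eq: "radial_param e v = radial_param e v'"
  define w where "w x = e + (x - (e \<bullet> x) *\<^sub>R e)" for x
  have ee: "e \<bullet> e = 1" using e by (simp add: dot_square_norm)
  have ew: "e \<bullet> w x = 1" for x unfolding w_def by (simp add: inner_simps ee)
  then have wnz: "w x \<noteq> 0" for x by (metis inner_zero_right zero_neq_one)
  have rad: "radial_param e x = radial_collar (e \<bullet> x) (sgn (w x))" for x
    unfolding radial_param_def w_def ..
  have same_r: "e \<bullet> v = e \<bullet> v' \<and> sgn (w v) = sgn (w v')"
  proof (cases "e \<bullet> v = 0 \<or> e \<bullet> v' = 0")
    case True
    then show ?thesis using eq unfolding rad radial_collar_def by (auto split: if_splits)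
  next
    case False
    then have *: "sgn (w v) /\<^sub>R (e \<bullet> v) = sgn (w v') /\<^sub>R (e \<bullet> v')"
      using eq unfolding rad radial_collar_def by simp
    have "norm (sgn (w v) /\<^sub>R (e \<bullet> v)) = norm (sgn (w v') /\<^sub>R (e \<bullet> v'))" by (simp only: *)
    then have "e \<bullet> v = e \<bullet> v'" using v wnz by (simp add: norm_sgn)
    then show ?thesis using * False by simp
  qed
  have "w v = w v'"
  proof -
    have "e \<bullet> sgn (w x) = inverse (norm (w x))" for x
      using ew by (simp add: sgn_div_norm)
    then have "norm (w v) = norm (w v')" using same_r by (metis inverse_inverse_eq)
    then show ?thesis using same_r wnz by (simp add: sgn_div_norm)
  qed
  then show "v = v'" using same_r by (simp add: w_def)
qed

lemma mfd_carrier_radial_atlas: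
  "mfd_carrier radial_atlas = range Fin \<union> Bdry ` sphere (0::'a::euclidean_space) 1"
proof -
  have "radial_param e v \<in> range Fin \<union> Bdry ` sphere 0 1" if "e \<in> sphere 0 1" for e v :: 'a
  proof -
    have "e \<bullet> e = 1" using that by (simp add: dot_square_norm)
    then have "e \<bullet> (e + (v - (e \<bullet> v) *\<^sub>R e)) = 1" by (simp add: inner_simps)
    then have "e + (v - (e \<bullet> v) *\<^sub>R e) \<noteq> 0" by (metis inner_zero_right zero_neq_one)
    then have "sgn (e + (v - (e \<bullet> v) *\<^sub>R e)) \<in> sphere 0 1" by (simp add: norm_sgn)
    then show ?thesis unfolding radial_param_def radial_collar_def
      by (metis UnI1 UnI2 imageI rangeI)
  qed
  then have "mfd_carrier radial_atlas \<subseteq> range Fin \<union> Bdry ` sphere (0::'a) 1"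
    unfolding mfd_carrier_def radial_atlas_def by blast
  moreover have "Bdry u \<in> mfd_carrier radial_atlas" if u: "u \<in> sphere 0 1" for u :: 'a
  proof -
    have "Bdry u = radial_param u 0"
      using u by (simp add: radial_param_def radial_collar_def sgn_div_norm)
    then have "Bdry u \<in> radial_param u ` {v. 0 \<le> u \<bullet> v}" by simp
    then show ?thesis using u unfolding mfd_carrier_def radial_atlas_def by blast
  qed
  moreover have "range Fin \<subseteq> mfd_carrier (radial_atlas :: ('a radial, 'a) atlas)"
    unfolding mfd_carrier_def radial_atlas_def by blast
  ultimately show ?thesis by blast
qed

lemma not_in_euclidean_boundary:
  assumes "open S" "x \<in> S" "S \<subseteq> M"
  shows "x \<notin> euclidean_boundary M"
proof
  assume "x \<in> euclidean_boundary M"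
  then obtain U \<Phi> L b where xU: "x \<in> U" and sl: "slice_chart U \<Phi> M L b"
    and b: "b \<noteq> 0" "b \<bullet> \<Phi> x = 0"
    unfolding euclidean_boundary_def by blast
  define g where "g = inv_into U \<Phi>"
  have "Ck_on 0 g (\<Phi> ` U)" using sl unfolding slice_chart_def smooth_on_def g_def by blast
  then have "continuous_on (\<Phi> ` U) g" by simp
  then have "open (\<Phi> ` U \<inter> g -` (S \<inter> U))"
    using sl assms(1) unfolding slice_chart_def by (intro continuous_open_preimage open_Int) simp_all
  moreover have "\<Phi> x \<in> \<Phi> ` U \<inter> g -` (S \<inter> U)"
    using sl xU assms unfolding g_def slice_chart_def by auto
  ultimately obtain d where d: "d > 0" "ball (\<Phi> x) d \<subseteq> \<Phi> ` U \<inter> g -` (S \<inter> U)"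
    by (meson openE)
  define y where "y = \<Phi> x - (d / (2 * norm b)) *\<^sub>R b"
  have "y \<in> ball (\<Phi> x) d" using d b by (simp add: y_def dist_norm)
  then have "y \<in> \<Phi> ` U" "g y \<in> S \<inter> U" using d by auto
  then have "\<Phi> (g y) = y" "g y \<in> M \<inter> U"
    using assms(3) f_inv_into_f[of y \<Phi> U] unfolding g_def by auto
  then have "y \<in> \<Phi> ` (M \<inter> U)" by (metis imageI)
  then have "0 \<le> b \<bullet> y" using sl unfolding slice_chart_def by auto
  moreover have "b \<bullet> y < 0" using d b by (simp add: y_def inner_simps)
  ultimately show False by simp
qed

lemma mfd_boundary_radial_atlas:
  "mfd_boundary radial_atlas (mfd_carrier radial_atlas) = Bdry ` sphere (0::'a::euclidean_space) 1"
proof -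
  define D where "D e = {v::'a. 0 \<le> e \<bullet> v}" for e
  let ?C = "mfd_carrier radial_atlas :: 'a radial set"
  have chart: "inv_into (D e) (radial_param e) ` (?C \<inter> radial_param e ` D e) = D e"
    if "e \<in> sphere 0 1" for e
  proof -
    have "radial_param e ` D e \<subseteq> ?C" using that unfolding mfd_carrier_def radial_atlas_def D_def by auto
    then show ?thesis using radial_param_inj[OF that] unfolding D_def
      by (simp add: Int_absorb1)
  qed
  have smooth_id: "smooth_on UNIV (\<lambda>v::'a. v)"
  proof -
    have const: "Ck_on k (\<lambda>_::'a. c::'a) UNIV" for k c by (induction k arbitrary: c) auto
    have "Ck_on k (\<lambda>v::'a. v) UNIV" for k by (cases k) (auto simp: const)
    then show ?thesis by (simp add: smooth_on_def)
  qed
  show ?thesis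
  proof (intro equalityI subsetI)
    fix p assume "p \<in> Bdry ` sphere (0::'a) 1"
    then obtain u where u: "u \<in> sphere 0 1" "p = Bdry u" by blast
    have pu: "p = radial_param u 0"
      using u by (simp add: radial_param_def radial_collar_def sgn_div_norm)
    have inv0: "inv_into (D u) (radial_param u) p = 0"
      unfolding pu using radial_param_inj[OF u(1)] by (intro inv_into_f_f) (auto simp: D_def)
    have "slice_chart UNIV (\<lambda>v. v) (D u) UNIV u"
      unfolding slice_chart_def using smooth_id inv_id[where ?'a = 'a] by (auto simp: D_def id_def)
    then have "0 \<in> euclidean_boundary (D u)"
      unfolding euclidean_boundary_def using u
      by (intro CollectI conjI exI[of _ UNIV] exI[of _ "\<lambda>v. v"] exI[of _ u]) (auto simp: D_def)
    moreover have "p \<in> ?C" using u unfolding mfd_carrier_radial_atlas by blast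
    moreover have "p \<in> radial_param u ` D u" unfolding pu D_def by auto
    moreover have "(radial_param u ` D u, inv_into (D u) (radial_param u)) \<in> radial_atlas"
      using u unfolding radial_atlas_def D_def by blast
    ultimately show "p \<in> mfd_boundary radial_atlas ?C"
      unfolding mfd_boundary_def
      by (intro CollectI conjI bexI[of _ "(radial_param u ` D u, inv_into (D u) (radial_param u))"])
        (auto simp only: prod.case chart[OF u(1)] inv0)
  next
    fix p assume p: "p \<in> mfd_boundary radial_atlas ?C"
    have "p \<notin> range Fin"
    proof
      assume "p \<in> range Fin"
      then obtain x where x: "p = Fin x" by blast
      obtain U \<phi> where c: "(U, \<phi>) \<in> radial_atlas" "p \<in> U" "\<phi> p \<in> euclidean_boundary (\<phi> ` (?C \<inter> U))"
        using p unfolding mfd_boundary_def by auto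
      consider "U = range Fin" "\<phi> = inv Fin"
        | e where "e \<in> sphere 0 1" "U = radial_param e ` D e" "\<phi> = inv_into (D e) (radial_param e)"
        using c(1) unfolding radial_atlas_def D_def by auto
      then show False
      proof cases
        case 1
        have "\<phi> ` (?C \<inter> U) = UNIV"
          unfolding 1 mfd_carrier_radial_atlas by (auto simp: Int_absorb1 image_image inj_def)
        then show False using c(3) not_in_euclidean_boundary[of UNIV "\<phi> p"] by simp
      next
        case 2
        obtain v where v: "v \<in> D e" "p = radial_param e v" using c(2) unfolding 2 by blast
        have pv: "\<phi> p = v" unfolding 2 v using radial_param_inj[OF 2(1)] v(1)
          unfolding D_def by simp
        have "e \<bullet> v \<noteq> 0" using v x unfolding radial_param_def radial_collar_def by auto
        then have "v \<in> {v. 0 < e \<bullet> v}" using v(1) unfolding D_def by simp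
        moreover have "open {v. 0 < e \<bullet> v}" by (simp add: open_halfspace_gt)
        moreover have "{v. 0 < e \<bullet> v} \<subseteq> D e" unfolding D_def by auto
        ultimately have "v \<notin> euclidean_boundary (D e)" by (metis not_in_euclidean_boundary)
        then show False using c(3) pv chart[OF 2(1)] unfolding 2 by simp
      qed
    qed
    moreover have "p \<in> ?C" using p unfolding mfd_boundary_def by blast
    ultimately show "p \<in> Bdry ` sphere 0 1" unfolding mfd_carrier_radial_atlas by blast
  qed
qed

section \<open>Sets that are conic at infinity\<close>

definition radial_closure :: "'a::euclidean_space set \<Rightarrow> 'a radial set" where
  "radial_closure Y = mfd_topology radial_atlas closure_of (Fin ` Y)"

definition directions_at_infinity :: "'a::euclidean_space set \<Rightarrow> 'a set" where
  "directions_at_infinity Y = {u \<in> sphere 0 1. Bdry u \<in> radial_closure Y}"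

definition conic_at_infinity :: "'a::euclidean_space set \<Rightarrow> bool" where
  "conic_at_infinity Y \<longleftrightarrow> bounded Y \<or>
     (directions_at_infinity Y \<noteq> {} \<and>
      (\<exists>N W. p_submanifold radial_atlas N \<and> openin (mfd_topology radial_atlas) W \<and>
         Bdry ` directions_at_infinity Y \<subseteq> W \<and> radial_closure Y \<inter> W = N \<inter> W))"

end

theory Submission
  imports Defs
begin

text \<open>Sending the boundary point \<open>u\<close> of the radial compactification to \<open>[u : 0]\<close> and the finite point \<open>x\<close> to
\<open>[x : 1]\<close> gives a map \<open>\<pi>\<close> onto projective space (\<open>radial_to_proj\<close>); in the collar it is
\<open>(r, u) \<mapsto> [u : r]\<close>. Over the real numbers it identifies opposite points of the boundary sphere, over the
complex numbers it collapses the circles \<open>{c u. |c| = 1}\<close> in this sphere and is no immersion there.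
In both cases \<open>\<pi>\<close> is smooth up to the boundary, and \<^emph>\<open>its restriction to the boundary is a
submersion onto the hyperplane at infinity \<open>H\<close>\<close>. This is the only property that matters at infinity, and
it lets both fields be treated at once.

Let \<open>X\<close> be transverse to \<open>H\<close>, and let \<open>F\<close> be a submersion onto a Euclidean space that vanishes exactly
on \<open>X\<close> near a point of \<open>X \<inter> H\<close>. By transversality \<open>dF\<close> is already onto when it is restricted to the
tangent space of \<open>H\<close>, so that \<open>d(F \<circ> \<pi>)\<close> is onto when it is restricted to the tangent space of the
boundary. Hence \<open>\<pi>\<^sup>-\<^sup>1(X)\<close> (\<open>radial_preimage\<close>) is a sub-manifold that meets the boundary transversely, that is,
a p-sub-manifold. At interior points \<open>\<pi>\<close> is a local diffeomorphism and there is nothing to show.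
A boundary point of \<open>\<pi>\<^sup>-\<^sup>1(X)\<close> can be left along a curve of \<open>\<pi>\<^sup>-\<^sup>1(X)\<close> that enters the interior,
and \<open>\<pi>\<^sup>-\<^sup>1(X)\<close> is closed as \<open>X\<close> is; so \<open>\<pi>\<^sup>-\<^sup>1(X)\<close> is exactly the closure of the affine part of
\<open>X\<close>, and the germ asked for is that of \<open>\<pi>\<^sup>-\<^sup>1(X)\<close> itself.

The technical core is \<open>slice_chart_pullback\<close>: a slice chart of \<open>X\<close> is pulled back to a slice chart of
the preimage that respects a given half-space. It uses the inverse function theorem for smooth maps
(\<open>smooth_inverse_function\<close>). The submersion property of \<open>\<pi>\<close> on the boundary is
\<open>proj_transition_onto_hyperplane\<close>.\<close>

section \<open>Calculus of smooth maps\<close>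

lemma Ck_on_subset: "Ck_on k f S \<Longrightarrow> T \<subseteq> S \<Longrightarrow> Ck_on k f T"
  by (induction k arbitrary: f) (auto intro: continuous_on_subset)

lemma Ck_on_cong:
  assumes "open S" "\<And>x. x \<in> S \<Longrightarrow> f x = g x" "Ck_on k f S"
  shows "Ck_on k g S"
  using assms
proof (induction k arbitrary: f g)
  case 0
  then show ?case by (auto intro: continuous_on_eq[of S f])
next
  case (Suc k)
  have D: "(g has_derivative frechet_derivative f (at x)) (at x)" if "x \<in> S" for x
  proof -
    have "(f has_derivative frechet_derivative f (at x)) (at x)"
      using Suc.prems(3) that by (simp add: frechet_derivative_works)
    then show ?thesis
      by (rule has_derivative_transform_within_open[OF _ Suc.prems(1) that]) (rule Suc.prems(2))
  qed
  have eq: "frechet_derivative f (at x) = frechet_derivative g (at x)" if "x \<in> S" for x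
    using D[OF that] by (rule frechet_derivative_at)
  have "Ck_on k (\<lambda>x. frechet_derivative g (at x) v) S" for v
  proof (rule Suc.IH[OF Suc.prems(1)])
    show "Ck_on k (\<lambda>x. frechet_derivative f (at x) v) S" using Suc.prems(3) by simp
  qed (simp only: eq)
  then show ?case using D by (auto simp: differentiable_def)
qed

text \<open>The derivative may be given by any formula, instead of by the choice operator behind
  \<open>frechet_derivative\<close>. The inductions on the order of differentiability below differentiate once
  and then use this rule.\<close>

lemma Ck_on_SucI:
  assumes "open S" "\<And>x. x \<in> S \<Longrightarrow> (f has_derivative f' x) (at x)"
    and "\<And>v. Ck_on k (\<lambda>x. f' x v) S"
  shows "Ck_on (Suc k) f S"
proof -
  have "Ck_on k (\<lambda>x. frechet_derivative f (at x) v) S" for v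
    by (rule Ck_on_cong[OF assms(1) _ assms(3)[of v]])
      (simp add: frechet_derivative_at[OF assms(2)])
  then show ?thesis using assms(2) by (auto simp: differentiable_def)
qed

lemma Ck_on_SucD:
  assumes "Ck_on (Suc k) f S"
  shows "x \<in> S \<Longrightarrow> (f has_derivative frechet_derivative f (at x)) (at x)"
    and "Ck_on k (\<lambda>x. frechet_derivative f (at x) v) S"
  using assms by (auto simp: frechet_derivative_works)

lemma Ck_on_lower: "Ck_on (Suc k) f S \<Longrightarrow> Ck_on k f S"
proof (induction k arbitrary: f)
  case 0
  then show ?case
    by (auto intro!: continuous_at_imp_continuous_on differentiable_imp_continuous_within)
next
  case (Suc k)
  have "Ck_on k (\<lambda>x. frechet_derivative f (at x) v) S" for v
    using Suc.prems by (intro Suc.IH Ck_on_SucD(2))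
  then show ?case using Suc.prems by simp
qed

lemma Ck_on_const: "Ck_on k (\<lambda>_. c) S"
  by (induction k arbitrary: c) auto

lemma Ck_on_linear_compose:
  assumes "bounded_linear h" "open S" "Ck_on k f S"
  shows "Ck_on k (\<lambda>x. h (f x)) S"
  using assms(3)
proof (induction k arbitrary: f)
  case 0
  then show ?case using assms(1) by (simp add: linear_continuous_on_compose bounded_linear.continuous_on)
next
  case (Suc k)
  show ?case
    by (rule Ck_on_SucI[OF assms(2) bounded_linear.has_derivative[OF assms(1) Ck_on_SucD(1)[OF Suc.prems]]])
      (auto intro: Suc.IH Ck_on_SucD(2)[OF Suc.prems])
qed

lemma Ck_on_ident: "open S \<Longrightarrow> Ck_on k (\<lambda>x. x) S"
proof (cases k)
  case (Suc k')
  assume "open S"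
  then show ?thesis unfolding Suc
    by (rule Ck_on_SucI[where f' = "\<lambda>_ v. v"]) (auto intro: Ck_on_const)
qed simp

lemma Ck_on_add:
  assumes "open S" "Ck_on k f S" "Ck_on k g S"
  shows "Ck_on k (\<lambda>x. f x + g x) S"
  using assms(2,3)
proof (induction k arbitrary: f g)
  case 0
  then show ?case by (simp add: continuous_on_add)
next
  case (Suc k)
  show ?case
    by (rule Ck_on_SucI[OF assms(1) has_derivative_add[OF Ck_on_SucD(1)[OF Suc.prems(1)] Ck_on_SucD(1)[OF Suc.prems(2)]]])
      (auto intro: Suc.IH Ck_on_SucD(2)[OF Suc.prems(1)] Ck_on_SucD(2)[OF Suc.prems(2)])
qed

lemma Ck_on_minus: "open S \<Longrightarrow> Ck_on k f S \<Longrightarrow> Ck_on k (\<lambda>x. - f x) S"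
  by (rule Ck_on_linear_compose[OF bounded_linear_minus[OF bounded_linear_ident]])

lemma Ck_on_diff:
  "open S \<Longrightarrow> Ck_on k f S \<Longrightarrow> Ck_on k g S \<Longrightarrow> Ck_on k (\<lambda>x. f x - g x) S"
  using Ck_on_add[OF _ _ Ck_on_minus] by fastforce

lemma Ck_on_sum:
  assumes "open S" "\<And>i. i \<in> I \<Longrightarrow> Ck_on k (f i) S"
  shows "Ck_on k (\<lambda>x. \<Sum>i\<in>I. f i x) S"
  using assms(2)
  by (induction I rule: infinite_finite_induct) (simp_all add: Ck_on_const Ck_on_add assms(1))

lemma Ck_on_bilinear:
  assumes "bounded_bilinear h" "open S" "Ck_on k f S" "Ck_on k g S"
  shows "Ck_on k (\<lambda>x. h (f x) (g x)) S"
  using assms(3,4)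
proof (induction k arbitrary: f g)
  case 0
  then show ?case using assms(1) by (simp add: bounded_bilinear.continuous_on)
next
  case (Suc k)
  have low: "Ck_on k f S" "Ck_on k g S" using Suc.prems by (auto intro: Ck_on_lower simp del: Ck_on.simps)
  show ?case
    by (rule Ck_on_SucI[OF assms(2) bounded_bilinear.FDERIV[OF assms(1)
            Ck_on_SucD(1)[OF Suc.prems(1)] Ck_on_SucD(1)[OF Suc.prems(2)]]])
      (auto intro!: Ck_on_add assms(2) Suc.IH low Ck_on_SucD(2)[OF Suc.prems(1)] Ck_on_SucD(2)[OF Suc.prems(2)])
qed

lemmas Ck_on_scaleR = Ck_on_bilinear[OF bounded_bilinear_scaleR]
  and Ck_on_inner = Ck_on_bilinear[OF bounded_bilinear_inner]
  and Ck_on_mult = Ck_on_bilinear[OF bounded_bilinear_mult]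

lemma linear_expand_Basis:
  fixes h :: "'a::euclidean_space \<Rightarrow> 'b::real_vector"
  assumes "linear h"
  shows "h x = (\<Sum>b\<in>Basis. (x \<bullet> b) *\<^sub>R h b)"
proof -
  have "h x = h (\<Sum>b\<in>Basis. (x \<bullet> b) *\<^sub>R b)" by (simp add: euclidean_representation)
  also have "\<dots> = (\<Sum>b\<in>Basis. (x \<bullet> b) *\<^sub>R h b)"
    by (simp add: linear_sum[OF assms] linear_cmul[OF assms])
  finally show ?thesis .
qed

text \<open>In the chain rule the derivative of \<open>f\<close> is taken in a direction that varies with the point.
  Expanding this direction in the basis leaves derivatives in fixed directions, to which the
  induction hypothesis applies.\<close>

lemma Ck_on_compose:
  fixes g :: "'a::real_normed_vector \<Rightarrow> 'b::euclidean_space" and f :: "'b \<Rightarrow> 'c::real_normed_vector"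
  assumes "open S" "g ` S \<subseteq> T" "Ck_on k f T" "Ck_on k g S"
  shows "Ck_on k (\<lambda>x. f (g x)) S"
  using assms(3,4)
proof (induction k arbitrary: f)
  case 0
  then show ?case using assms(2) by (auto intro: continuous_on_compose2)
next
  case (Suc k)
  let ?f' = "\<lambda>y. frechet_derivative f (at y)" and ?g' = "\<lambda>x. frechet_derivative g (at x)"
  have lin: "linear (?f' (g x))" if "x \<in> S" for x
    using Ck_on_SucD(1)[OF Suc.prems(1), of "g x"] assms(2) that
    by (auto intro: has_derivative_linear)
  show ?case
  proof (rule Ck_on_SucI[OF assms(1)])
    fix x assume x: "x \<in> S"
    then have "((\<lambda>x. f (g x)) has_derivative (\<lambda>v. ?f' (g x) (?g' x v))) (at x)"
      using has_derivative_compose[OF Ck_on_SucD(1)[OF Suc.prems(2)] Ck_on_SucD(1)[OF Suc.prems(1), of "g x"]]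
        assms(2) by auto
    moreover have "?f' (g x) (?g' x v) = (\<Sum>b\<in>Basis. (?g' x v \<bullet> b) *\<^sub>R ?f' (g x) b)" for v
      by (rule linear_expand_Basis[OF lin[OF x]])
    ultimately show "((\<lambda>x. f (g x)) has_derivative
        (\<lambda>v. \<Sum>b\<in>Basis. (?g' x v \<bullet> b) *\<^sub>R ?f' (g x) b)) (at x)"
      by simp
  next
    fix v
    show "Ck_on k (\<lambda>x. \<Sum>b\<in>Basis. (?g' x v \<bullet> b) *\<^sub>R ?f' (g x) b) S"
      by (intro Ck_on_sum Ck_on_scaleR assms(1) Ck_on_inner Ck_on_const Ck_on_SucD(2)[OF Suc.prems(2)]
          Suc.IH Ck_on_SucD(2)[OF Suc.prems(1)] Ck_on_lower[OF Suc.prems(2)])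
  qed
qed

lemma Ck_on_inverse:
  "Ck_on k (inverse :: 'a::real_normed_field \<Rightarrow> 'a) (- {0})"
proof (induction k)
  case 0
  then show ?case by (auto intro: continuous_on_inverse continuous_on_id)
next
  case (Suc k)
  show ?case
    by (rule Ck_on_SucI[where f' = "\<lambda>x h. - (inverse x * h * inverse x)"])
      (auto intro!: Ck_on_minus Ck_on_mult Ck_on_const Suc.IH has_derivative_inverse')
qed

lemma Ck_on_norm:
  "Ck_on k (norm :: 'a::euclidean_space \<Rightarrow> real) (- {0})"
proof (induction k)
  case 0
  then show ?case by (auto intro: continuous_on_norm continuous_on_id)
next
  case (Suc k)
  show ?case
  proof (rule Ck_on_SucI[where f' = "\<lambda>x h. (x \<bullet> h) * inverse (norm x)"])
    fix x :: 'a assume "x \<in> - {0}"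
    then show "(norm has_derivative (\<lambda>h. x \<bullet> h * inverse (norm x))) (at x)"
      using has_derivative_norm[of x] by (simp add: sgn_div_norm inner_commute mult.commute)
  next
    show "Ck_on k (\<lambda>x. (x \<bullet> v) * inverse (norm x)) (- {0})" for v :: 'a
      by (intro Ck_on_mult Ck_on_inner Ck_on_const Ck_on_ident
          Ck_on_compose[OF _ _ Ck_on_inverse Suc.IH]) auto
  qed auto
qed

lemma smooth_on_has_derivative:
  "smooth_on S f \<Longrightarrow> x \<in> S \<Longrightarrow> (f has_derivative frechet_derivative f (at x)) (at x)"
  unfolding smooth_on_def by (blast intro: Ck_on_SucD(1))

lemma smooth_on_continuous: "smooth_on S f \<Longrightarrow> continuous_on S f"
  unfolding smooth_on_def by (metis Ck_on.simps(1))

lemma smooth_on_subset: "smooth_on S f \<Longrightarrow> T \<subseteq> S \<Longrightarrow> smooth_on T f"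
  unfolding smooth_on_def by (blast intro: Ck_on_subset)

lemma smooth_on_cong:
  "open S \<Longrightarrow> (\<And>x. x \<in> S \<Longrightarrow> f x = g x) \<Longrightarrow> smooth_on S f \<Longrightarrow> smooth_on S g"
  unfolding smooth_on_def by (blast intro: Ck_on_cong)

lemma smooth_on_compose:
  fixes g :: "'a::real_normed_vector \<Rightarrow> 'b::euclidean_space" and f :: "'b \<Rightarrow> 'c::real_normed_vector"
  shows "open S \<Longrightarrow> g ` S \<subseteq> T \<Longrightarrow> smooth_on T f \<Longrightarrow> smooth_on S g \<Longrightarrow> smooth_on S (\<lambda>x. f (g x))"
  unfolding smooth_on_def by (blast intro: Ck_on_compose)

text \<open>A product rule in which one factor is only continuous, at the price that the other one vanishes at
  the point. It yields differentiability of \<open>B\<close> from continuity of \<open>B\<close> in the next lemma.\<close>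

lemma has_derivative_scaleR_vanishing:
  fixes f :: "'a::real_normed_vector \<Rightarrow> real" and g :: "'a \<Rightarrow> 'b::real_normed_vector"
  assumes f: "(f has_derivative f') (at x)" and "f x = 0" and g: "isCont g x"
  shows "((\<lambda>y. f y *\<^sub>R g y) has_derivative (\<lambda>h. f' h *\<^sub>R g x)) (at x)"
proof -
  interpret f': bounded_linear f' using f by (rule has_derivative_bounded_linear)
  obtain K where K: "\<And>h. norm (f' h) \<le> norm h * K" using f'.bounded by blast
  define q where "q y = (f y - f x - f' (y - x)) /\<^sub>R norm (y - x)" for y
  have q: "(q \<longlongrightarrow> 0) (at x)" using f unfolding q_def by (simp add: has_derivative_at_within)
  have lim: "((\<lambda>y. q y *\<^sub>R g y + (f' (y - x) / norm (y - x)) *\<^sub>R (g y - g x)) \<longlongrightarrow> 0) (at x)"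
  proof -
    have "((\<lambda>y. q y *\<^sub>R g y) \<longlongrightarrow> 0 *\<^sub>R g x) (at x)"
      using q g unfolding isCont_def by (rule tendsto_scaleR)
    moreover have "((\<lambda>y. (f' (y - x) / norm (y - x)) *\<^sub>R (g y - g x)) \<longlongrightarrow> 0) (at x)"
    proof (rule Lim_null_comparison)
      show "((\<lambda>y. \<bar>K\<bar> * norm (g y - g x)) \<longlongrightarrow> 0) (at x)"
        using g unfolding isCont_def by (auto intro!: tendsto_eq_intros)
      have "norm ((f' (y - x) / norm (y - x)) *\<^sub>R (g y - g x)) \<le> \<bar>K\<bar> * norm (g y - g x)" for y
      proof -
        have "\<bar>f' (y - x)\<bar> \<le> norm (y - x) * \<bar>K\<bar>"
          using K[of "y - x"] mult_left_mono[OF abs_ge_self[of K] norm_ge_zero[of "y - x"]] by simp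
        then have "\<bar>f' (y - x)\<bar> / norm (y - x) \<le> \<bar>K\<bar>"
          by (cases "y = x") (auto simp: divide_simps mult.commute)
        then have "\<bar>f' (y - x)\<bar> / norm (y - x) * norm (g y - g x) \<le> \<bar>K\<bar> * norm (g y - g x)"
          by (rule mult_right_mono) simp
        then show ?thesis by simp
      qed
      then show "\<forall>\<^sub>F y in at x. norm ((f' (y - x) / norm (y - x)) *\<^sub>R (g y - g x)) \<le> \<bar>K\<bar> * norm (g y - g x)"
        by simp
    qed
    ultimately show ?thesis using tendsto_add by fastforce
  qed
  have "((\<lambda>y. (f y *\<^sub>R g y - f x *\<^sub>R g x - f' (y - x) *\<^sub>R g x) /\<^sub>R norm (y - x)) \<longlongrightarrow> 0) (at x)"
  proof -
    have "(f y *\<^sub>R g y - f x *\<^sub>R g x - f' (y - x) *\<^sub>R g x) /\<^sub>R norm (y - x)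
      = q y *\<^sub>R g y + (f' (y - x) / norm (y - x)) *\<^sub>R (g y - g x)" for y
      using \<open>f x = 0\<close> by (simp add: q_def algebra_simps divide_inverse)
    then show ?thesis using lim by simp
  qed
  then show ?thesis
    by (simp add: has_derivative_at_within bounded_linear_scaleR_const f'.bounded_linear_axioms)
qed

text \<open>Inversion of linear maps is smooth. The proof avoids operator spaces and determinants: with
  \<open>A(x) B(x) w = w\<close> one has \<open>B(y) w = B(x) w - B(y) \<xi>(y)\<close>, where \<open>\<xi>(y) = A(y) B(x) w - w\<close> is as regular
  as \<open>A\<close> and vanishes at \<open>x\<close>. Expanding \<open>\<xi>\<close> in the basis gives the derivative
  \<open>- B(x) (dA(x)) B(x) w\<close>, to which the induction hypothesis on \<open>B\<close> applies.
  The uniform bound on \<open>B\<close> gives its continuity.\<close>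

lemma Ck_on_inverse_family:
  fixes A B :: "'a::real_normed_vector \<Rightarrow> 'e::euclidean_space \<Rightarrow> 'e"
  assumes S: "open S"
    and linA: "\<And>y. y \<in> S \<Longrightarrow> linear (A y)" and linB: "\<And>y. y \<in> S \<Longrightarrow> linear (B y)"
    and BA: "\<And>y w. y \<in> S \<Longrightarrow> B y (A y w) = w" and AB: "\<And>y w. y \<in> S \<Longrightarrow> A y (B y w) = w"
    and bnd: "\<And>y w. y \<in> S \<Longrightarrow> norm (B y w) \<le> C * norm w"
    and "\<And>w. Ck_on k (\<lambda>y. A y w) S"
  shows "Ck_on k (\<lambda>y. B y w) S"
  using assms(7)
proof (induction k arbitrary: w)
  case 0
  have "isCont (\<lambda>y. B y w) x" if x: "x \<in> S" for x
  proof -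
    let ?b = "B x w"
    have "isCont (\<lambda>y. A y ?b) x"
      using 0 x S by (simp add: continuous_on_eq_continuous_at)
    then have "((\<lambda>y. \<bar>C\<bar> * norm (A y ?b - A x ?b)) \<longlongrightarrow> 0) (at x)"
      unfolding isCont_def by (auto intro!: tendsto_eq_intros)
    moreover have "\<forall>\<^sub>F y in at x. norm (B y w - ?b) \<le> \<bar>C\<bar> * norm (A y ?b - A x ?b)"
    proof -
      have "norm (B y w - ?b) \<le> \<bar>C\<bar> * norm (A y ?b - A x ?b)" if y: "y \<in> S" for y
      proof -
        have "B y w - ?b = - B y (A y ?b - A x ?b)"
          by (simp add: linear_diff[OF linB[OF y]] BA[OF y] AB[OF x])
        then have "norm (B y w - ?b) \<le> C * norm (A y ?b - A x ?b)"
          using bnd[OF y] by simp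
        also have "\<dots> \<le> \<bar>C\<bar> * norm (A y ?b - A x ?b)" by (simp add: mult_right_mono)
        finally show ?thesis .
      qed
      then show ?thesis using S x by (auto intro: eventually_at_in_open' eventually_mono)
    qed
    ultimately have "((\<lambda>y. B y w - ?b) \<longlongrightarrow> 0) (at x)" by (rule Lim_null_comparison[rotated])
    then show ?thesis unfolding isCont_def by (simp add: LIM_zero_iff)
  qed
  then show ?case by (simp add: continuous_at_imp_continuous_on)
next
  case (Suc k)
  have IH: "Ck_on k (\<lambda>y. B y w) S" for w
    using Suc.IH Ck_on_lower[OF Suc.prems] by blast
  have cont: "isCont (\<lambda>y. B y w) x" if "x \<in> S" for x w
  proof -
    have "continuous_on S (\<lambda>y. B y w)"
    proof (cases k)
      case 0
      then show ?thesis using IH by simp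
    next
      case (Suc j)
      then show ?thesis using IH[of w]
        by (auto intro!: continuous_at_imp_continuous_on differentiable_imp_continuous_within)
    qed
    then show ?thesis using that S by (simp add: continuous_on_eq_continuous_at)
  qed
  define A' where "A' x h c = frechet_derivative (\<lambda>y. A y c) (at x) h" for x h c
  define q where "q x h = (\<Sum>c\<in>Basis. (B x w \<bullet> c) *\<^sub>R A' x h c)" for x h
  show ?case
  proof (rule Ck_on_SucI[OF S])
    fix x assume x: "x \<in> S"
    define \<xi> where "\<xi> y = (\<Sum>c\<in>Basis. (B x w \<bullet> c) *\<^sub>R A y c) - w" for y
    have \<xi>_eq: "\<xi> y = A y (B x w) - w" if "y \<in> S" for y
      unfolding \<xi>_def using linear_expand_Basis[OF linA[OF that]] by metis
    have D\<xi>: "(\<xi> has_derivative q x) (at x)"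
      unfolding \<xi>_def q_def A'_def
      by (auto intro!: derivative_eq_intros Ck_on_SucD(1)[OF Suc.prems x])
    have "((\<lambda>y. \<Sum>b\<in>Basis. (\<xi> y \<bullet> b) *\<^sub>R B y b) has_derivative
        (\<lambda>h. \<Sum>b\<in>Basis. (q x h \<bullet> b) *\<^sub>R B x b)) (at x)"
      by (intro has_derivative_sum has_derivative_scaleR_vanishing cont x
          has_derivative_inner_left D\<xi>) (simp add: \<xi>_eq x AB)
    then have "((\<lambda>y. B x w - (\<Sum>b\<in>Basis. (\<xi> y \<bullet> b) *\<^sub>R B y b)) has_derivative
        (\<lambda>h. - (\<Sum>b\<in>Basis. (q x h \<bullet> b) *\<^sub>R B x b))) (at x)"
      using has_derivative_diff[OF has_derivative_const] by fastforce
    moreover have "B x w - (\<Sum>b\<in>Basis. (\<xi> y \<bullet> b) *\<^sub>R B y b) = B y w" if y: "y \<in> S" for y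
      unfolding linear_expand_Basis[OF linB[OF y], of "\<xi> y", symmetric]
      by (simp add: \<xi>_eq[OF y] linear_diff[OF linB[OF y]] BA[OF y])
    ultimately show "((\<lambda>y. B y w) has_derivative (\<lambda>h. - (\<Sum>b\<in>Basis. (q x h \<bullet> b) *\<^sub>R B x b))) (at x)"
      by (rule has_derivative_transform_within_open[OF _ S x])
  next
    fix v
    have "Ck_on k (\<lambda>x. q x v) S" unfolding q_def A'_def
      by (intro Ck_on_sum Ck_on_scaleR Ck_on_inner Ck_on_const S IH Ck_on_SucD(2)[OF Suc.prems])
    then show "Ck_on k (\<lambda>x. - (\<Sum>b\<in>Basis. (q x v \<bullet> b) *\<^sub>R B x b)) S"
      by (intro Ck_on_minus Ck_on_sum Ck_on_scaleR Ck_on_inner Ck_on_const S IH)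
  qed
qed

section \<open>The inverse function theorem for smooth maps\<close>

text \<open>Normalizing the derivative at \<open>x0\<close> to the identity keeps the derivatives near \<open>x0\<close> within distance
  \<open>1/2\<close> of it, and so bounds their inverses by \<open>2\<close>, which \<open>Ck_on_inverse_family\<close> needs. The formula
  \<open>dg(y) = (df(g y))\<^sup>-\<^sup>1\<close> then raises the regularity of the inverse \<open>g\<close> step by step.\<close>

lemma smooth_inverse_function:
  fixes f :: "'e::euclidean_space \<Rightarrow> 'e"
  assumes W: "open W" "x0 \<in> W" and f: "smooth_on W f" and d: "(f has_derivative (\<lambda>h. h)) (at x0)"
  obtains U where "open U" "x0 \<in> U" "U \<subseteq> W" "open (f ` U)" "inj_on f U"
    "smooth_on (f ` U) (inv_into U f)"
proof -
  define D where "D x = frechet_derivative f (at x)" for x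
  define F where "F x = Blinfun (D x)" for x
  have DD: "(f has_derivative D x) (at x)" if "x \<in> W" for x
    unfolding D_def using smooth_on_has_derivative[OF f that] .
  have F: "blinfun_apply (F x) = D x" if "x \<in> W" for x
    unfolding F_def using has_derivative_bounded_linear[OF DD[OF that]] by (rule bounded_linear_Blinfun_apply)
  have CD: "Ck_on k (\<lambda>x. D x w) W" for k w
    unfolding D_def using f unfolding smooth_on_def by (blast intro: Ck_on_SucD(2))
  have contF: "continuous_on W F"
  proof (rule continuous_on_blinfun_componentwise)
    fix b :: 'e
    have "continuous_on W (\<lambda>x. D x b)" using CD[of 0] by simp
    then show "continuous_on W (\<lambda>x. F x b)" by (simp add: F cong: continuous_on_cong)
  qed
  have D0: "D x0 = (\<lambda>h. h)" using has_derivative_unique[OF DD[OF W(2)] d] .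
  define W1 where "W1 = {x \<in> W. dist (F x) id_blinfun < 1/2}"
  have F0: "F x0 = id_blinfun" by (rule blinfun_eqI) (simp add: F W D0)
  have W1: "open W1"
  proof -
    have "W1 = W \<inter> F -` ball id_blinfun (1/2)" by (auto simp: W1_def dist_commute)
    then show ?thesis using continuous_open_preimage[OF contF W(1) open_ball] by simp
  qed
  have x0: "x0 \<in> W1" using W by (simp add: W1_def F0)
  have low: "norm w \<le> 2 * norm (D x w)" if x: "x \<in> W1" for x w
  proof -
    have "norm (w - D x w) = norm ((id_blinfun - F x) w)"
      using x by (simp add: F W1_def blinfun.diff_left)
    also have "\<dots> \<le> norm (id_blinfun - F x) * norm w" by (rule norm_blinfun)
    also have "\<dots> \<le> 1/2 * norm w"
      using x by (intro mult_right_mono) (auto simp: W1_def dist_norm norm_minus_commute)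
    finally show ?thesis using norm_triangle_ineq2[of w "D x w"] by simp
  qed
  obtain U V g g' where U: "open U" "U \<subseteq> W1" "x0 \<in> U" and V: "open V"
    and hom: "homeomorphism U V f g"
    and g: "\<And>y. y \<in> V \<Longrightarrow> (g has_derivative (g' y)) (at y)"
    and g': "\<And>y. y \<in> V \<Longrightarrow> g' y = inv (blinfun_apply (F (g y)))"
    and bij: "\<And>y. y \<in> V \<Longrightarrow> bij (blinfun_apply (F (g y)))"
  proof (rule inverse_function_theorem[of W1 f F x0 id_blinfun])
    show "(f has_derivative blinfun_apply (F x)) (at x)" if "x \<in> W1" for x
      using that by (simp add: W1_def F DD)
    show "continuous_on W1 F" using contF by (rule continuous_on_subset) (auto simp: W1_def)
    show "id_blinfun o\<^sub>L F x0 = id_blinfun" by (rule blinfun_eqI) (simp add: F0)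
  qed (use W1 x0 in blast)+
  have gV: "g y \<in> U" if "y \<in> V" for y using hom that unfolding homeomorphism_def by blast
  have fg: "f (g y) = y" if "y \<in> V" for y using hom that unfolding homeomorphism_def by blast
  have gf: "g (f x) = x" if "x \<in> U" for x using hom that unfolding homeomorphism_def by blast
  have V_eq: "f ` U = V" using hom unfolding homeomorphism_def by blast
  have UW: "U \<subseteq> W" using U by (auto simp: W1_def)
  have gW: "g y \<in> W" "g y \<in> W1" if "y \<in> V" for y using gV[OF that] UW U by blast+
  have bijD: "bij (D (g y))" and g'D: "g' y = inv (D (g y))" if "y \<in> V" for y
    using bij[OF that] g'[OF that] F[OF gW(1)[OF that]] by auto
  have Ckg: "Ck_on k g V" for k
  proof (induction k)
    case 0
    then show ?case using hom by (simp add: homeomorphism_def)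
  next
    case (Suc k)
    have Dg: "Ck_on k (\<lambda>y. g' y w) V" for w
    proof (rule Ck_on_inverse_family[where A = "\<lambda>y. D (g y)" and C = 2, OF V])
      fix y assume y: "y \<in> V"
      show "linear (D (g y))" using DD[OF gW(1)[OF y]] by (rule has_derivative_linear)
      show "linear (g' y)" using g[OF y] by (rule has_derivative_linear)
      show "g' y (D (g y) w) = w" for w
        unfolding g'D[OF y] using bijD[OF y] by (simp add: bij_is_inj)
      show *: "D (g y) (g' y w) = w" for w
        unfolding g'D[OF y] using bijD[OF y] by (simp add: bij_is_surj surj_f_inv_f)
      show "norm (g' y w) \<le> 2 * norm w" for w
        using low[OF gW(2)[OF y], of "g' y w"] by (simp add: *)
    next
      show "Ck_on k (\<lambda>y. D (g y) w) V" for w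
        by (rule Ck_on_compose[OF V _ CD Suc]) (use gW in auto)
    qed
    show ?case by (rule Ck_on_SucI[OF V g Dg])
  qed
  show ?thesis
  proof (rule that[of U])
    show inj: "inj_on f U" by (metis gf inj_onI)
    show "smooth_on (f ` U) (inv_into U f)"
    proof (rule smooth_on_cong[of _ g])
      fix y assume "y \<in> f ` U"
      then have y: "y \<in> V" by (simp add: V_eq)
      show "g y = inv_into U f y"
        using inv_into_f_f[OF inj gV[OF y]] fg[OF y] by simp
    qed (use V Ckg in \<open>auto simp: V_eq smooth_on_def\<close>)
  qed (use U UW V V_eq in auto)
qed

section \<open>Curves and linear algebra\<close>

lemma has_vector_derivative_chain:
  assumes "(\<gamma> has_vector_derivative w) (at t)" "(f has_derivative f') (at (\<gamma> t))"
  shows "((\<lambda>s. f (\<gamma> s)) has_vector_derivative f' w) (at t)"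
proof -
  interpret f': bounded_linear f' using assms(2) by (rule has_derivative_bounded_linear)
  show ?thesis
    using has_derivative_compose[of \<gamma> _ t UNIV f f', OF _ assms(2)] assms(1)
    unfolding has_vector_derivative_def by (fastforce simp: f'.scaleR)
qed

text \<open>The curves that define tangent vectors stay in the given set for non-negative times only, so a
  constraint on them is a constraint from the right.\<close>

lemma right_vector_derivative_of_constant:
  fixes f :: "real \<Rightarrow> 'a::real_normed_vector"
  assumes f: "(f has_vector_derivative d) (at 0)" and "0 < \<delta>" and c: "\<And>t. 0 \<le> t \<Longrightarrow> t < \<delta> \<Longrightarrow> f t = c"
  shows "d = 0"
proof -
  have "(f has_vector_derivative d) (at 0 within {0..<\<delta>})"
    using f by (rule has_vector_derivative_at_within)
  moreover have "(f has_vector_derivative 0) (at 0 within {0..<\<delta>})"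
    by (rule has_vector_derivative_transform[of _ _ _ "\<lambda>_. c"]) (use \<open>0 < \<delta>\<close> c in auto)
  moreover have "at 0 within {0..<\<delta>} \<noteq> bot"
  proof -
    have "{0..<\<delta>} - {0} = {0<..<\<delta>}" by auto
    then show ?thesis using \<open>0 < \<delta>\<close> by (simp add: at_within_eq_bot_iff)
  qed
  ultimately show ?thesis using vector_derivative_unique_within by blast
qed

lemma orthogonal_projection_exists:
  fixes L :: "'e::euclidean_space set"
  assumes "subspace L"
  shows "\<exists>P. linear P \<and> (\<forall>x. P x = 0 \<longleftrightarrow> x \<in> L) \<and> (\<forall>x. x - P x \<in> L) \<and> (\<forall>x. \<forall>l\<in>L. P x \<bullet> l = 0)"
proof -
  have "\<exists>z. x - z \<in> L \<and> (\<forall>l\<in>L. z \<bullet> l = 0)" for x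
  proof -
    obtain y z where "y \<in> span L" "\<And>w. w \<in> span L \<Longrightarrow> orthogonal z w" "x = y + z"
      using orthogonal_subspace_decomp_exists by metis
    then show ?thesis using assms
      by (intro exI[of _ z]) (auto simp: span_eq_iff[THEN iffD2] orthogonal_def)
  qed
  then obtain P where P: "\<And>x. x - P x \<in> L" "\<And>x l. l \<in> L \<Longrightarrow> P x \<bullet> l = 0" by metis
  have uniq: "P x = z" if "x - z \<in> L" "\<And>l. l \<in> L \<Longrightarrow> z \<bullet> l = 0" for x z
  proof -
    have "(x - z) - (x - P x) \<in> L" by (rule subspace_diff[OF assms that(1) P(1)])
    then have "P x - z \<in> L" by simp
    then have "(P x - z) \<bullet> (P x - z) = 0"
      using P(2)[of "P x - z" x] that(2)[of "P x - z"] by (simp add: inner_diff_left)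
    then show ?thesis by simp
  qed
  have "linear P"
  proof
    show "P (x + y) = P x + P y" for x y
    proof (rule uniq)
      have "(x - P x) + (y - P y) \<in> L" using P assms by (intro subspace_add)
      then show "x + y - (P x + P y) \<in> L" by (simp add: algebra_simps)
    qed (simp add: inner_add_left P)
    show "P (c *\<^sub>R x) = c *\<^sub>R P x" for c x
    proof (rule uniq)
      have "c *\<^sub>R (x - P x) \<in> L" using P assms by (intro subspace_scale)
      then show "c *\<^sub>R x - c *\<^sub>R P x \<in> L" by (simp add: algebra_simps)
    qed (simp add: P)
  qed
  moreover have "P x = 0 \<longleftrightarrow> x \<in> L" for x
    using P(1)[of x] uniq[of x 0] by auto
  ultimately show ?thesis using P by blast
qed

lemma dim_kernel_plus_dim_range:
  fixes f :: "'a::euclidean_space \<Rightarrow> 'b::euclidean_space"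
  assumes f: "linear f"
  shows "dim {x. f x = 0} + dim (range f) = DIM('a)"
proof -
  let ?K = "{x. f x = 0}" and ?C = "{y. \<forall>x\<in>{x. f x = 0}. orthogonal x y}"
  have K: "subspace ?K" using f by (rule linear_subspace_kernel)
  obtain P where "linear P" "\<And>x. P x = 0 \<longleftrightarrow> x \<in> ?K"
    and P: "\<And>x. x - P x \<in> ?K" "\<And>x l. l \<in> ?K \<Longrightarrow> P x \<bullet> l = 0"
    using orthogonal_projection_exists[OF K] by blast
  have "subspace ?C" by (auto simp: subspace_def orthogonal_def inner_simps)
  then have "span ?C = ?C" by simp
  have "inj_on f ?C"
  proof (rule inj_onI)
    fix x y assume xy: "x \<in> ?C" "y \<in> ?C" "f x = f y"
    then have "x - y \<in> ?K" using f by (simp add: linear_diff)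
    moreover have "x - y \<in> ?C" using xy by (simp add: orthogonal_def inner_diff_right)
    ultimately have "orthogonal (x - y) (x - y)" by blast
    then show "x = y" by (simp add: orthogonal_def)
  qed
  then have "inj_on f (span ?C)" by (simp only: \<open>span ?C = ?C\<close>)
  with f have "dim (f ` ?C) = dim ?C" by (rule dim_image_eq)
  moreover have "f ` ?C = range f"
  proof -
    have "f x \<in> f ` ?C" for x
    proof -
      have "f (P x) = f x" using P(1)[of x] f by (simp add: linear_diff)
      moreover have "P x \<in> ?C" using P(2) by (auto simp: orthogonal_def inner_commute)
      ultimately show ?thesis by (metis imageI)
    qed
    then show ?thesis by auto
  qed
  moreover have "dim ?C + dim ?K = DIM('a)"
    using dim_subspace_orthogonal_to_vectors[OF K subspace_UNIV] by simp
  ultimately show ?thesis by simp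
qed

section \<open>Slice charts\<close>

lemma slice_chart_D:
  assumes "slice_chart U \<Phi> N L b"
  shows "open U" "open (\<Phi> ` U)" "inj_on \<Phi> U" "smooth_on U \<Phi>" "smooth_on (\<Phi> ` U) (inv_into U \<Phi>)"
    "subspace L" "b \<in> L"
    and "x \<in> U \<Longrightarrow> x \<in> N \<longleftrightarrow> \<Phi> x \<in> L \<and> 0 \<le> b \<bullet> \<Phi> x"
proof -
  show inj: "inj_on \<Phi> U" using assms by (simp add: slice_chart_def)
  assume "x \<in> U"
  have img: "\<Phi> ` (N \<inter> U) = \<Phi> ` U \<inter> {v \<in> L. 0 \<le> b \<bullet> v}" using assms by (simp add: slice_chart_def)
  have "x \<in> N \<longleftrightarrow> \<Phi> x \<in> \<Phi> ` (N \<inter> U)"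
    using \<open>x \<in> U\<close> inj by (auto dest: inj_onD)
  then show "x \<in> N \<longleftrightarrow> \<Phi> x \<in> L \<and> 0 \<le> b \<bullet> \<Phi> x" unfolding img using \<open>x \<in> U\<close> by simp
qed (use assms in \<open>auto simp: slice_chart_def\<close>)

lemma slice_chartI:
  assumes "open U" "open (\<Phi> ` U)" "inj_on \<Phi> U" "smooth_on U \<Phi>" "smooth_on (\<Phi> ` U) (inv_into U \<Phi>)"
    "subspace L" "b \<in> L" "\<And>x. x \<in> U \<Longrightarrow> x \<in> N \<longleftrightarrow> \<Phi> x \<in> L \<and> 0 \<le> b \<bullet> \<Phi> x"
  shows "slice_chart U \<Phi> N L b"
  using assms unfolding slice_chart_def by auto

text \<open>A point with \<open>b \<bullet> \<Phi> x > 0\<close> lies off the wall of the half-space, and shrinking the chart makes the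
  constraint void.\<close>

lemma interior_slice_chart:
  assumes "euclidean_submanifold k N" "x \<in> N" "x \<notin> euclidean_boundary N"
  obtains U \<Phi> L where "x \<in> U" "slice_chart U \<Phi> N L 0" "dim L = k"
proof -
  obtain U \<Phi> L b where c: "x \<in> U" "slice_chart U \<Phi> N L b" "dim L = k"
    using assms(1,2) unfolding euclidean_submanifold_def by blast
  note sc = slice_chart_D[OF c(2)]
  show ?thesis
  proof (cases "b = 0")
    case True
    then show ?thesis using c that by blast
  next
    case False
    define U' where "U' = {y \<in> U. 0 < b \<bullet> \<Phi> y}"
    have "b \<bullet> \<Phi> x \<noteq> 0" using assms(2,3) c False unfolding euclidean_boundary_def by blast
    then have xU': "x \<in> U'" using sc(8)[OF c(1)] assms(2) c(1) by (simp add: U'_def)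
    have img: "\<Phi> ` U' = \<Phi> ` U \<inter> {v. 0 < b \<bullet> v}" by (auto simp: U'_def)
    have sub: "U' \<subseteq> U" by (auto simp: U'_def)
    have U': "open U'"
    proof -
      have "U' = U \<inter> \<Phi> -` {v. 0 < b \<bullet> v}" by (auto simp: U'_def)
      then show ?thesis
        using continuous_open_preimage[OF smooth_on_continuous[OF sc(4)] sc(1) open_halfspace_gt[of 0 b]] by simp
    qed
    have inj: "inj_on \<Phi> U'" using sc(3) sub by (rule inj_on_subset)
    have op: "open (\<Phi> ` U')" unfolding img by (intro open_Int sc open_halfspace_gt)
    have "slice_chart U' \<Phi> N L 0"
    proof (rule slice_chartI)
      show "smooth_on U' \<Phi>" using sc(4) sub by (rule smooth_on_subset)
      show "smooth_on (\<Phi> ` U') (inv_into U' \<Phi>)"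
      proof (rule smooth_on_cong[OF op])
        show "smooth_on (\<Phi> ` U') (inv_into U \<Phi>)" using sc(5) by (rule smooth_on_subset) (use sub in auto)
        show "inv_into U \<Phi> y = inv_into U' \<Phi> y" if y: "y \<in> \<Phi> ` U'" for y
        proof -
          obtain u where u: "u \<in> U'" "y = \<Phi> u" using y by blast
          then have "u \<in> U" using sub by blast
          then show ?thesis using inv_into_f_f[OF inj u(1)] inv_into_f_f[OF sc(3)] u(2) by simp
        qed
      qed
      show "y \<in> N \<longleftrightarrow> \<Phi> y \<in> L \<and> 0 \<le> 0 \<bullet> \<Phi> y" if "y \<in> U'" for y
        using that sc(8) by (auto simp: U'_def)
    qed (use U' op inj sc subspace_0 in auto)
    then show ?thesis using that xU' c by blast
  qed
qed

text \<open>Straight segments in the slice are carried back to \<open>N\<close>. They are the source of curves that start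
  at boundary points and enter the interior.\<close>

lemma slice_chart_curve:
  assumes c: "slice_chart U \<Phi> N L b" and x: "x \<in> N" "x \<in> U" and d: "d \<in> L" "0 \<le> b \<bullet> d"
  obtains \<gamma> \<epsilon> w where "0 < \<epsilon>" "smooth_on {-\<epsilon><..<\<epsilon>} \<gamma>" "\<gamma> 0 = x"
    "\<forall>t\<in>{-\<epsilon><..<\<epsilon>}. \<gamma> t \<in> U \<and> \<Phi> (\<gamma> t) = \<Phi> x + t *\<^sub>R d"
    "\<forall>t\<in>{0..<\<epsilon>}. \<gamma> t \<in> N"
    "(\<gamma> has_vector_derivative w) (at (0::real))" "frechet_derivative \<Phi> (at x) w = d"
proof -
  note sc = slice_chart_D[OF c]
  define l where "l t = \<Phi> x + t *\<^sub>R d" for t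
  have "continuous_on UNIV l" unfolding l_def by (intro continuous_intros)
  then have "open (l -` (\<Phi> ` U))" by (rule open_vimage[OF sc(2)])
  moreover have "0 \<in> l -` (\<Phi> ` U)" using x by (simp add: l_def)
  ultimately obtain \<epsilon> where \<epsilon>: "0 < \<epsilon>" "ball 0 \<epsilon> \<subseteq> l -` (\<Phi> ` U)" by (meson openE)
  have int: "{-\<epsilon><..<\<epsilon>} = ball (0::real) \<epsilon>" by (auto simp: dist_real_def)
  define \<gamma> where "\<gamma> t = inv_into U \<Phi> (l t)" for t
  have lU: "l t \<in> \<Phi> ` U" if "t \<in> {-\<epsilon><..<\<epsilon>}" for t using that \<epsilon> int by blast
  have \<gamma>: "\<gamma> t \<in> U \<and> \<Phi> (\<gamma> t) = \<Phi> x + t *\<^sub>R d" if "t \<in> {-\<epsilon><..<\<epsilon>}" for t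
    using lU[OF that] inv_into_into[of "l t" \<Phi> U] f_inv_into_f[of "l t" \<Phi> U] by (simp add: \<gamma>_def l_def)
  have "smooth_on {-\<epsilon><..<\<epsilon>} l" unfolding l_def smooth_on_def
    by (auto intro!: Ck_on_add Ck_on_const Ck_on_scaleR Ck_on_ident)
  then have smooth: "smooth_on {-\<epsilon><..<\<epsilon>} \<gamma>" unfolding \<gamma>_def
    by (intro smooth_on_compose[OF _ _ sc(5)]) (use lU in auto)
  have \<gamma>0: "\<gamma> 0 = x" using x sc(3) by (simp add: \<gamma>_def l_def)
  have "(\<gamma> has_derivative frechet_derivative \<gamma> (at 0)) (at 0)"
    using smooth \<epsilon> by (auto intro: smooth_on_has_derivative)
  then obtain w where w: "(\<gamma> has_vector_derivative w) (at 0)"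
    by (metis differentiable_def vector_derivative_works)
  have "((\<lambda>t. \<Phi> (\<gamma> t)) has_vector_derivative frechet_derivative \<Phi> (at x) w) (at 0)"
    by (rule has_vector_derivative_chain) (use w smooth_on_has_derivative[OF sc(4) x(2)] in \<open>simp_all add: \<gamma>0\<close>)
  moreover have "((\<lambda>t. \<Phi> (\<gamma> t)) has_vector_derivative d) (at 0)"
  proof (rule has_vector_derivative_transform_within_open[of _ _ _ "{-\<epsilon><..<\<epsilon>}"])
    show "(l has_vector_derivative d) (at 0)" unfolding l_def by (auto intro!: derivative_eq_intros)
  qed (use \<epsilon> \<gamma> in \<open>auto simp: l_def\<close>)
  ultimately have Dw: "frechet_derivative \<Phi> (at x) w = d" by (rule vector_derivative_unique_at)
  have \<gamma>N: "\<gamma> t \<in> N" if t: "t \<in> {0..<\<epsilon>}" for t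
  proof -
    have "\<Phi> x \<in> L" "0 \<le> b \<bullet> \<Phi> x" using sc(8)[OF x(2)] x(1) by auto
    then have "\<Phi> x + t *\<^sub>R d \<in> L \<and> 0 \<le> b \<bullet> (\<Phi> x + t *\<^sub>R d)"
      using t d sc(6) by (auto simp: inner_simps subspace_add subspace_scale)
    then show ?thesis using \<gamma>[of t] sc(8)[of "\<gamma> t"] t by auto
  qed
  show ?thesis by (rule that[OF \<epsilon>(1) smooth \<gamma>0 _ _ w Dw]) (use \<gamma> \<gamma>N in auto)
qed

lemma velocity_in_slice:
  assumes c: "slice_chart U \<Phi> N L b" and x: "x \<in> U"
    and \<gamma>: "(\<gamma> has_vector_derivative v) (at (0::real))" "\<gamma> 0 = x" and \<delta>: "0 < \<delta>" "\<And>t. 0 \<le> t \<Longrightarrow> t < \<delta> \<Longrightarrow> \<gamma> t \<in> N"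
  shows "frechet_derivative \<Phi> (at x) v \<in> L"
proof -
  note sc = slice_chart_D[OF c]
  obtain P where P: "linear P" "\<And>y. P y = 0 \<longleftrightarrow> y \<in> L" and "\<And>y. y - P y \<in> L"
    using orthogonal_projection_exists[OF sc(6)] by blast
  have "isCont \<gamma> 0" using \<gamma>(1) by (rule has_vector_derivative_continuous)
  then have "\<forall>\<^sub>F t in at 0. \<gamma> t \<in> U"
    using \<gamma>(2) x sc(1) by (auto simp: isCont_def intro: topological_tendstoD)
  then obtain \<epsilon> where \<epsilon>: "0 < \<epsilon>" "\<And>t. \<bar>t\<bar> < \<epsilon> \<Longrightarrow> t \<noteq> 0 \<Longrightarrow> \<gamma> t \<in> U"
    unfolding eventually_at by (auto simp: dist_real_def)
  have "((\<lambda>t. \<Phi> (\<gamma> t)) has_vector_derivative frechet_derivative \<Phi> (at x) v) (at 0)"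
    by (rule has_vector_derivative_chain) (use \<gamma> smooth_on_has_derivative[OF sc(4) x] in \<open>auto\<close>)
  then have "((\<lambda>t. P (\<Phi> (\<gamma> t))) has_vector_derivative P (frechet_derivative \<Phi> (at x) v)) (at 0)"
    by (rule has_vector_derivative_chain) (simp add: P linear_imp_has_derivative)
  then have "P (frechet_derivative \<Phi> (at x) v) = 0"
  proof (rule right_vector_derivative_of_constant)
    show "0 < min \<delta> \<epsilon>" using \<delta> \<epsilon> by simp
    show "P (\<Phi> (\<gamma> t)) = 0" if "0 \<le> t" "t < min \<delta> \<epsilon>" for t
    proof -
      have "\<gamma> t \<in> U" using that \<epsilon>(2)[of t] \<gamma>(2) x by (cases "t = 0") auto
      then show ?thesis using \<delta>(2)[of t] that sc(8)[of "\<gamma> t"] P by simp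
    qed
  qed
  then show ?thesis using P by simp
qed

text \<open>Smooth invariance of the boundary. If \<open>x\<close> had a boundary chart \<open>\<Psi>\<close> with inner normal \<open>b\<close>, some curve in
  \<open>N\<close> would start at \<open>x\<close> with a velocity \<open>a\<close> that \<open>d\<Psi>\<close> sends to \<open>b\<close>. The interior chart shows that \<open>- a\<close> is
  the velocity of a curve in \<open>N\<close> as well; but this curve leaves the half-space.\<close>

lemma slice_interior_not_in_boundary:
  assumes c: "slice_chart U \<Phi> N L 0" and x: "x \<in> N" "x \<in> U"
  shows "x \<notin> euclidean_boundary N"
proof
  assume "x \<in> euclidean_boundary N"
  then obtain V \<Psi> M b where V: "x \<in> V" "slice_chart V \<Psi> N M b" and b: "b \<noteq> 0" "b \<bullet> \<Psi> x = 0"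
    unfolding euclidean_boundary_def by blast
  note sc = slice_chart_D[OF c] and sv = slice_chart_D[OF V(2)]
  let ?\<Phi>' = "frechet_derivative \<Phi> (at x)" and ?\<Psi>' = "frechet_derivative \<Psi> (at x)"
  have lin: "linear ?\<Phi>'" "linear ?\<Psi>'"
    using smooth_on_has_derivative sc(4) x(2) sv(4) V(1) by (blast intro: has_derivative_linear)+
  obtain \<gamma> \<epsilon> a where \<gamma>: "0 < \<epsilon>" "\<gamma> 0 = x" "\<And>t. t \<in> {0..<\<epsilon>} \<Longrightarrow> \<gamma> t \<in> N"
    "(\<gamma> has_vector_derivative a) (at (0::real))" "?\<Psi>' a = b"
    using slice_chart_curve[OF V(2) x(1) V(1) sv(7)] by (metis inner_ge_zero)
  have "?\<Phi>' a \<in> L"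
    using \<gamma>(3) by (intro velocity_in_slice[OF c x(2) \<gamma>(4,2,1)]) auto
  then have "- ?\<Phi>' a \<in> L" using sc(6) by (simp add: subspace_neg)
  then obtain \<eta> \<delta> w where \<eta>: "0 < \<delta>" "\<eta> 0 = x" "\<And>t. t \<in> {0..<\<delta>} \<Longrightarrow> \<eta> t \<in> N"
    "(\<eta> has_vector_derivative w) (at (0::real))" "?\<Phi>' w = - ?\<Phi>' a"
    using slice_chart_curve[OF c x] by (metis inner_zero_left order_refl)
  have "w = - a"
  proof -
    have "((\<lambda>y. inv_into U \<Phi> (\<Phi> y)) has_derivative
        (\<lambda>h. frechet_derivative (inv_into U \<Phi>) (at (\<Phi> x)) (?\<Phi>' h))) (at x)"
      using has_derivative_compose[OF smooth_on_has_derivative[OF sc(4) x(2)]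
          smooth_on_has_derivative[OF sc(5)]] x(2) by blast
    moreover have "((\<lambda>y. inv_into U \<Phi> (\<Phi> y)) has_derivative (\<lambda>h. h)) (at x)"
      by (rule has_derivative_transform_within_open[OF has_derivative_ident sc(1) x(2)])
        (simp add: sc(3))
    ultimately have "(\<lambda>h. frechet_derivative (inv_into U \<Phi>) (at (\<Phi> x)) (?\<Phi>' h)) = (\<lambda>h. h)"
      by (rule has_derivative_unique)
    moreover have "?\<Phi>' w = ?\<Phi>' (- a)" using \<eta>(5) lin(1) by (simp add: linear_neg)
    ultimately show ?thesis by metis
  qed
  then have neg: "b \<bullet> ?\<Psi>' w < 0" using \<gamma>(5) lin(2) b by (simp add: linear_neg)
  have \<Psi>\<eta>: "((\<lambda>t. \<Psi> (\<eta> t)) has_vector_derivative ?\<Psi>' w) (at 0)"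
    by (rule has_vector_derivative_chain) (use \<eta> smooth_on_has_derivative[OF sv(4) V(1)] in \<open>auto\<close>)
  have "((\<lambda>t. b \<bullet> \<Psi> (\<eta> t)) has_vector_derivative b \<bullet> ?\<Psi>' w) (at 0)"
    by (rule has_vector_derivative_chain[OF \<Psi>\<eta>, of "\<lambda>y. b \<bullet> y"])
      (simp add: bounded_linear_inner_right bounded_linear_imp_has_derivative)
  then have "((\<lambda>t. b \<bullet> \<Psi> (\<eta> t)) has_real_derivative b \<bullet> ?\<Psi>' w) (at 0)"
    by (simp add: has_real_derivative_iff_has_vector_derivative)
  from DERIV_neg_dec_right[OF this neg]
  obtain d where d: "0 < d" "\<And>h. 0 < h \<Longrightarrow> h < d \<Longrightarrow> b \<bullet> \<Psi> (\<eta> h) < 0"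
    using \<eta>(2) b(2) by auto
  have "isCont \<eta> 0" using \<eta>(4) by (rule has_vector_derivative_continuous)
  then have "\<forall>\<^sub>F t in at 0. \<eta> t \<in> V"
    using \<eta>(2) V(1) sv(1) by (auto simp: isCont_def intro: topological_tendstoD)
  then obtain \<epsilon>' where \<epsilon>': "0 < \<epsilon>'" "\<And>t. \<bar>t\<bar> < \<epsilon>' \<Longrightarrow> t \<noteq> 0 \<Longrightarrow> \<eta> t \<in> V"
    unfolding eventually_at by (auto simp: dist_real_def)
  define t where "t = min d (min \<epsilon>' \<delta>) / 2"
  have t: "0 < t" "t < d" "t < \<epsilon>'" "t < \<delta>" using d \<epsilon>' \<eta>(1) by (auto simp: t_def)
  have "\<eta> t \<in> V" "\<eta> t \<in> N" using \<epsilon>'(2)[of t] \<eta>(3)[of t] t by auto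
  then have "0 \<le> b \<bullet> \<Psi> (\<eta> t)" using sv(8) by blast
  then show False using d(2)[of t] t by auto
qed

text \<open>In the chart, \<open>N\<close> is the zero set of \<open>P \<circ> \<Phi>\<close>, where \<open>P\<close> is the orthogonal projection with kernel \<open>L\<close>.
  So its preimage is the zero set of \<open>G = P \<circ> \<Phi> \<circ> \<psi>\<close>. By hypothesis the derivative \<open>S\<close> of \<open>G\<close> at \<open>x\<close> has the same range
  as \<open>P\<close> even on the hyperplane orthogonal to \<open>e\<close>, so it has a right inverse \<open>T\<close> with values in that
  hyperplane. The map \<open>\<Theta> v = (v - x) + T (G v - S (v - x))\<close> has the identity as derivative at \<open>x\<close>;
  it satisfies \<open>S \<circ> \<Theta> = G\<close>, so it straightens the preimage to the kernel of \<open>S\<close>, and it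
  preserves the function \<open>e \<bullet> v\<close>, so it respects the half-space. On the kernel this function is the
  product with the orthogonal projection \<open>b\<close> of \<open>e\<close>. The choice \<open>e = 0\<close> covers preimages without boundary.\<close>

lemma slice_chart_pullback:
  fixes \<psi> :: "'e::euclidean_space \<Rightarrow> 'e" and e :: 'e
  assumes c: "slice_chart U \<Phi> N L 0" and O: "open D" "x \<in> D" and \<psi>: "smooth_on D \<psi>"
    and x: "\<psi> x \<in> N" "\<psi> x \<in> U" and e: "e \<bullet> x = 0"
    and trans: "\<And>y. \<exists>w. e \<bullet> w = 0 \<and>
      frechet_derivative \<Phi> (at (\<psi> x)) (frechet_derivative \<psi> (at x) w - y) \<in> L"
  obtains U' \<Phi>' L' b where "x \<in> U'" "U' \<subseteq> D" "slice_chart U' \<Phi>' {v \<in> D. \<psi> v \<in> N \<and> 0 \<le> e \<bullet> v} L' b"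
    "dim L' = dim L" "\<Phi>' x = 0" "\<forall>v\<in>U'. e \<bullet> \<Phi>' v = e \<bullet> v"
    "\<forall>u\<in>L'. e \<bullet> u = b \<bullet> u" "e \<noteq> 0 \<longrightarrow> b \<noteq> 0"
proof -
  note sc = slice_chart_D[OF c]
  define \<Phi>1 \<psi>1 where "\<Phi>1 = frechet_derivative \<Phi> (at (\<psi> x))" and "\<psi>1 = frechet_derivative \<psi> (at x)"
  have D\<Phi>: "(\<Phi> has_derivative \<Phi>1) (at (\<psi> x))" unfolding \<Phi>1_def using smooth_on_has_derivative[OF sc(4) x(2)] .
  have D\<psi>: "(\<psi> has_derivative \<psi>1) (at x)" unfolding \<psi>1_def using smooth_on_has_derivative[OF \<psi> O(2)] .
  have lin: "linear \<Phi>1" "linear \<psi>1" using D\<Phi> D\<psi> by (auto intro: has_derivative_linear)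
  obtain P where P: "linear P" "\<And>y. P y = 0 \<longleftrightarrow> y \<in> L" and "\<And>y. y - P y \<in> L"
    using orthogonal_projection_exists[OF sc(6)] by blast
  have surj: "\<exists>y. \<Phi>1 y = z" for z
  proof -
    let ?g = "inv_into U \<Phi>" and ?p = "\<Phi> (\<psi> x)"
    have p: "?p \<in> \<Phi> ` U" using x(2) by blast
    have gp: "?g ?p = \<psi> x" using sc(3) x(2) by simp
    have "((\<lambda>y. \<Phi> (?g y)) has_derivative (\<lambda>h. \<Phi>1 (frechet_derivative ?g (at ?p) h))) (at ?p)"
      using has_derivative_compose[OF smooth_on_has_derivative[OF sc(5) p], of \<Phi> \<Phi>1] D\<Phi> gp by simp
    moreover have "((\<lambda>y. \<Phi> (?g y)) has_derivative (\<lambda>h. h)) (at ?p)"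
      by (rule has_derivative_transform_within_open[OF has_derivative_ident sc(2) p])
        (simp add: f_inv_into_f)
    ultimately have "(\<lambda>h. \<Phi>1 (frechet_derivative ?g (at ?p) h)) = (\<lambda>h. h)"
      by (rule has_derivative_unique)
    then show ?thesis by metis
  qed
  define S where "S w = P (\<Phi>1 (\<psi>1 w))" for w
  have linS: "linear S" unfolding S_def
    using linear_compose[OF linear_compose[OF lin(2,1)] P(1)] by (simp add: o_def)
  have onto: "\<exists>w. e \<bullet> w = 0 \<and> S w = P z" for z
  proof -
    obtain y where y: "\<Phi>1 y = z" using surj by blast
    obtain w where w: "e \<bullet> w = 0" "\<Phi>1 (\<psi>1 w - y) \<in> L" using trans unfolding \<Phi>1_def \<psi>1_def by blast
    then have "P (\<Phi>1 (\<psi>1 w - y)) = 0" using P(2) by blast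
    then have "S w = P z" using y lin P(1) by (simp add: S_def linear_diff)
    then show ?thesis using w by blast
  qed
  obtain T where T: "linear T" "\<And>c. e \<bullet> T c = 0" "\<And>z. S (T (P z)) = P z"
  proof -
    have "subspace {w. e \<bullet> w = 0}" by (simp add: subspace_hyperplane)
    then obtain T where T: "range T \<subseteq> {w. e \<bullet> w = 0}" "linear T" "\<forall>v\<in>S ` {w. e \<bullet> w = 0}. S (T v) = v"
      using linear_exists_right_inverse_on[OF linS] by blast
    have "S (T (P z)) = P z" for z
    proof -
      obtain w where "e \<bullet> w = 0" "S w = P z" using onto[of z] by auto
      then have "P z \<in> S ` {w. e \<bullet> w = 0}" by (intro image_eqI[of _ _ w]) simp_all
      then show ?thesis by (rule bspec[OF T(3)])
    qed
    moreover have "e \<bullet> T c = 0" for c using T(1) by blast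
    ultimately show ?thesis by (rule that[OF T(2), rotated])
  qed
  define G where "G v = P (\<Phi> (\<psi> v))" for v
  define \<Theta> where "\<Theta> v = (v - x) + T (G v - S (v - x))" for v
  define W where "W = D \<inter> \<psi> -` U"
  have W: "open W" unfolding W_def using smooth_on_continuous[OF \<psi>] O(1) sc(1) by (intro continuous_open_preimage)
  have xW: "x \<in> W" using O x by (simp add: W_def)
  have G0: "G x = 0" using sc(8)[OF x(2)] x(1) P by (simp add: G_def)
  have S\<Theta>: "S (\<Theta> v) = G v" for v
  proof -
    have "G v - S (v - x) = P (\<Phi> (\<psi> v) - \<Phi>1 (\<psi>1 (v - x)))"
      unfolding G_def S_def using P(1) by (simp add: linear_diff)
    then have "S (T (G v - S (v - x))) = G v - S (v - x)" using T(3) by simp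
    then show ?thesis unfolding \<Theta>_def by (simp add: linear_add[OF linS])
  qed
  have e\<Theta>: "e \<bullet> \<Theta> v = e \<bullet> v" for v by (simp add: \<Theta>_def inner_simps T(2) e)
  have smW: "smooth_on W \<Theta>"
  proof -
    have "smooth_on W (\<lambda>v. \<Phi> (\<psi> v))"
      by (rule smooth_on_compose[OF W _ sc(4) smooth_on_subset[OF \<psi>]]) (auto simp: W_def)
    then show ?thesis
      unfolding \<Theta>_def G_def smooth_on_def using P(1) T(1) linS W
      by (intro allI Ck_on_add Ck_on_diff Ck_on_const Ck_on_ident Ck_on_linear_compose[of T]
          Ck_on_linear_compose[of P] Ck_on_linear_compose[of S])
        (auto simp: linear_conv_bounded_linear)
  qed
  have "(\<Theta> has_derivative (\<lambda>h. h)) (at x)"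
  proof -
    have DG: "(G has_derivative S) (at x)" unfolding G_def S_def
      using bounded_linear.has_derivative[OF _ has_derivative_compose[OF D\<psi> D\<Phi>]] P(1)
      by (simp add: linear_conv_bounded_linear)
    have *: "((\<lambda>v. v - x) has_derivative (\<lambda>h. h)) (at x)"
      by (auto intro!: derivative_eq_intros)
    then have "((\<lambda>v. S (v - x)) has_derivative S) (at x)"
      using bounded_linear.has_derivative[of S "\<lambda>v. v - x" "\<lambda>h. h" "at x"] linS
      by (simp add: linear_conv_bounded_linear)
    with DG have "((\<lambda>v. G v - S (v - x)) has_derivative (\<lambda>h. S h - S h)) (at x)"
      by (rule has_derivative_diff)
    from bounded_linear.has_derivative[OF _ this, of T]
    have "((\<lambda>v. T (G v - S (v - x))) has_derivative (\<lambda>h. 0)) (at x)"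
      using T(1) linear_0[OF T(1)] by (simp add: linear_conv_bounded_linear)
    from has_derivative_add[OF * this] show ?thesis unfolding \<Theta>_def by simp
  qed
  with W xW smW obtain U' where U': "open U'" "x \<in> U'" "U' \<subseteq> W" "open (\<Theta> ` U')" "inj_on \<Theta> U'"
    "smooth_on (\<Theta> ` U') (inv_into U' \<Theta>)"
    by (rule smooth_inverse_function)
  define L' where "L' = {u. S u = 0}"
  have subL': "subspace L'" unfolding L'_def using linS by (rule linear_subspace_kernel)
  obtain Q where "linear Q" "\<And>u. Q u = 0 \<longleftrightarrow> u \<in> L'"
    and Q: "\<And>u. u - Q u \<in> L'" "\<And>u l. l \<in> L' \<Longrightarrow> Q u \<bullet> l = 0"
    using orthogonal_projection_exists[OF subL'] by blast
  \<comment> \<open>the definition of slice charts wants the inner normal inside the slice \<open>L'\<close>\<close>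
  define b where "b = e - Q e"
  have b: "b \<in> L'" unfolding b_def by (rule Q)
  have eb: "e \<bullet> u = b \<bullet> u" if "u \<in> L'" for u using Q(2)[OF that] by (simp add: b_def inner_diff_left)
  have bnz: "b \<noteq> 0" if "e \<noteq> 0"
  proof
    assume "b = 0"
    \<comment> \<open>subtracting \<open>T (S e)\<close> moves \<open>e\<close> into the kernel of \<open>S\<close> without changing its product with \<open>e\<close>\<close>
    have "S (T (S e)) = S e" using T(3)[of "\<Phi>1 (\<psi>1 e)"] by (simp add: S_def)
    then have "e - T (S e) \<in> L'" unfolding L'_def by (simp add: linear_diff[OF linS])
    then have "e \<bullet> (e - T (S e)) = 0" using eb \<open>b = 0\<close> by simp
    then show False using \<open>e \<noteq> 0\<close> by (simp add: inner_diff_right T(2))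
  qed
  have chart: "slice_chart U' \<Theta> {v \<in> D. \<psi> v \<in> N \<and> 0 \<le> e \<bullet> v} L' b"
  proof (rule slice_chartI)
    show "smooth_on U' \<Theta>" using smW U'(3) by (rule smooth_on_subset)
    show "v \<in> {v \<in> D. \<psi> v \<in> N \<and> 0 \<le> e \<bullet> v} \<longleftrightarrow> \<Theta> v \<in> L' \<and> 0 \<le> b \<bullet> \<Theta> v" if "v \<in> U'" for v
    proof -
      have v: "v \<in> D" "\<psi> v \<in> U" using that U' by (auto simp: W_def)
      have "\<psi> v \<in> N \<longleftrightarrow> \<Theta> v \<in> L'" using sc(8)[OF v(2)] P S\<Theta>[of v] by (simp add: L'_def G_def)
      then show ?thesis using v eb[of "\<Theta> v"] e\<Theta>[of v] by auto
    qed
  qed (use U' subL' b in auto)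
  have dimL': "dim L' = dim L"
  proof -
    have "range S = range P"
    proof
      show "range S \<subseteq> range P" by (auto simp: S_def)
      show "range P \<subseteq> range S" using onto by (metis image_subsetI rangeI)
    qed
    moreover have "{y. P y = 0} = L" using P by auto
    ultimately show ?thesis
      using dim_kernel_plus_dim_range[OF linS] dim_kernel_plus_dim_range[OF P(1)] by (simp add: L'_def)
  qed
  have \<Theta>x: "\<Theta> x = 0" using linear_0[OF linS] linear_0[OF T(1)] by (simp add: \<Theta>_def G0)
  have U'D: "U' \<subseteq> D" using U' by (auto simp: W_def)
  show ?thesis by (rule that[OF U'(2) U'D chart dimL' \<Theta>x]) (use e\<Theta> eb bnz in auto)
qed

section \<open>Tangent spaces\<close>

lemma euclidean_tangent_velocity:
  assumes "0 < \<epsilon>" "smooth_on {-\<epsilon><..<\<epsilon>} \<gamma>" "\<gamma> 0 = x" "\<gamma> ` {0..<\<epsilon>} \<subseteq> N"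
    "(\<gamma> has_vector_derivative v) (at (0::real))"
  shows "v \<in> euclidean_tangent N x"
  unfolding euclidean_tangent_def using assms by (intro span_base) blast

lemma euclidean_tangent_line:
  assumes "\<And>t. 0 \<le> t \<Longrightarrow> x + t *\<^sub>R v \<in> N"
  shows "v \<in> euclidean_tangent N x"
proof (rule euclidean_tangent_velocity[of 1 "\<lambda>t. x + t *\<^sub>R v"])
  show "smooth_on {-1<..<1::real} (\<lambda>t. x + t *\<^sub>R v)" unfolding smooth_on_def
    by (auto intro!: Ck_on_add Ck_on_const Ck_on_scaleR Ck_on_ident)
  show "((\<lambda>t. x + t *\<^sub>R v) has_vector_derivative v) (at 0)" by (auto intro!: derivative_eq_intros)
qed (use assms in auto)

lemma euclidean_tangent_mono: "N \<subseteq> M \<Longrightarrow> euclidean_tangent N x \<subseteq> euclidean_tangent M x"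
  unfolding euclidean_tangent_def by (rule span_mono) blast

lemma subspace_euclidean_tangent: "subspace (euclidean_tangent N x)"
  unfolding euclidean_tangent_def by (rule subspace_span)

lemma euclidean_tangent_UNIV: "euclidean_tangent UNIV x = UNIV"
  using euclidean_tangent_line[of x _ UNIV] by auto

lemma euclidean_tangent_slice:
  assumes c: "slice_chart U \<Phi> N L b" and x: "x \<in> U" and v: "v \<in> euclidean_tangent N x"
  shows "frechet_derivative \<Phi> (at x) v \<in> L"
proof -
  have lin: "linear (frechet_derivative \<Phi> (at x))"
    using smooth_on_has_derivative[OF slice_chart_D(4)[OF c] x] by (rule has_derivative_linear)
  have "euclidean_tangent N x \<subseteq> {v. frechet_derivative \<Phi> (at x) v \<in> L}"
    unfolding euclidean_tangent_def
  proof (rule span_minimal)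
    show "subspace {v. frechet_derivative \<Phi> (at x) v \<in> L}"
      using linear_subspace_vimage[OF lin slice_chart_D(6)[OF c]] by (simp add: vimage_def)
  next
    show "{v. \<exists>\<gamma> e. 0 < e \<and> smooth_on {-e<..<e} \<gamma> \<and> \<gamma> 0 = x \<and>
     \<gamma> ` {0..<e} \<subseteq> N \<and> (\<gamma> has_vector_derivative v) (at (0::real))} \<subseteq> {v. frechet_derivative \<Phi> (at x) v \<in> L}"
    proof safe
      fix v \<gamma> and e :: real
      assume \<gamma>: "0 < e" "\<gamma> ` {0..<e} \<subseteq> N" "(\<gamma> has_vector_derivative v) (at 0)" "x = \<gamma> 0"
      show "frechet_derivative \<Phi> (at (\<gamma> 0)) v \<in> L"
        by (rule velocity_in_slice[OF c _ \<gamma>(3) _ \<gamma>(1)]) (use \<gamma> x in \<open>auto simp: image_subset_iff\<close>)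
    qed
  qed
  then show ?thesis using v by blast
qed

lemma euclidean_tangent_kernel:
  fixes P :: "'a::euclidean_space \<Rightarrow> 'b::euclidean_space"
  assumes P: "linear P" and v: "v \<in> euclidean_tangent {y. P y = 0} x"
  shows "P v = 0"
proof -
  have "euclidean_tangent {y. P y = 0} x \<subseteq> {v. P v = 0}"
    unfolding euclidean_tangent_def
  proof (rule span_minimal)
    show "{v. \<exists>\<gamma> e. 0 < e \<and> smooth_on {-e<..<e} \<gamma> \<and> \<gamma> 0 = x \<and>
     \<gamma> ` {0..<e} \<subseteq> {y. P y = 0} \<and> (\<gamma> has_vector_derivative v) (at (0::real))} \<subseteq> {v. P v = 0}"
    proof safe
      fix v \<gamma> and e :: real
      assume \<gamma>: "0 < e" "\<gamma> ` {0..<e} \<subseteq> {y. P y = 0}" "(\<gamma> has_vector_derivative v) (at 0)"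
      have "((\<lambda>t. P (\<gamma> t)) has_vector_derivative P v) (at 0)"
        using \<gamma>(3) by (rule has_vector_derivative_chain) (simp add: P linear_imp_has_derivative)
      then show "P v = 0" by (rule right_vector_derivative_of_constant[OF _ \<gamma>(1), of _ _ 0]) (use \<gamma> in \<open>auto simp: image_subset_iff\<close>)
    qed
  qed (rule linear_subspace_kernel[OF P])
  then show ?thesis using v by blast
qed

section \<open>Charts given by parametrizations\<close>

lemma inv_into_image_Int:
  assumes "inj_on p D"
  shows "inv_into D p ` (X \<inter> p ` D) = {y \<in> D. p y \<in> X}"
proof
  show "inv_into D p ` (X \<inter> p ` D) \<subseteq> {y \<in> D. p y \<in> X}"
    using assms by (auto simp: inv_into_f_f)
  show "{y \<in> D. p y \<in> X} \<subseteq> inv_into D p ` (X \<inter> p ` D)"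
  proof
    fix y assume "y \<in> {y \<in> D. p y \<in> X}"
    then show "y \<in> inv_into D p ` (X \<inter> p ` D)"
      using inv_into_f_f[OF assms, of y] by (intro image_eqI[of _ _ "p y"]) auto
  qed
qed

lemma openin_pullback_inv_into:
  assumes "inj_on p D"
  shows "openin (pullback_topology (p ` D) (inv_into D p) euclidean) S \<longleftrightarrow> (\<exists>V. open V \<and> S = p ` (V \<inter> D))"
proof -
  have "inv_into D p -` V \<inter> p ` D = p ` (V \<inter> D)" for V
    using assms by (auto simp: inv_into_f_f)
  then show ?thesis by (simp add: openin_pullback_topology)
qed

lemma slice_chart_cong:
  "slice_chart U \<Phi> N L b \<Longrightarrow> N \<inter> U = N' \<inter> U \<Longrightarrow> slice_chart U \<Phi> N' L b"
  unfolding slice_chart_def by simp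

text \<open>Used to see that \<open>d\<close> is in the range of a derivative: it suffices to lift a straight line of
  direction \<open>d\<close> through \<open>\<psi>\<close>, and no formula for \<open>\<psi>'\<close> is needed.\<close>

lemma derivative_along_lifted_line:
  assumes "(\<psi> has_derivative \<psi>') (at x)" "(\<sigma> has_vector_derivative w) (at (0::real))" "\<sigma> 0 = x"
    and "0 < \<delta>" "\<And>s. \<bar>s\<bar> < \<delta> \<Longrightarrow> \<psi> (\<sigma> s) = y + s *\<^sub>R d"
  shows "\<psi>' w = d"
proof -
  have "((\<lambda>s. \<psi> (\<sigma> s)) has_vector_derivative \<psi>' w) (at 0)"
    by (rule has_vector_derivative_chain) (use assms in auto)
  moreover have "((\<lambda>s. \<psi> (\<sigma> s)) has_vector_derivative d) (at 0)"
  proof (rule has_vector_derivative_transform_within_open[of _ _ _ "{-\<delta><..<\<delta>}"])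
    show "((\<lambda>s. y + s *\<^sub>R d) has_vector_derivative d) (at 0)" by (auto intro!: derivative_eq_intros)
  qed (use assms in auto)
  ultimately show ?thesis by (rule vector_derivative_unique_at)
qed

lemma Ck_on_has_vector_derivative:
  assumes "Ck_on (Suc 0) \<sigma> S" "(t::real) \<in> S"
  obtains w where "(\<sigma> has_vector_derivative w) (at t)"
  using Ck_on_SucD(1)[OF assms] by (metis differentiable_def vector_derivative_works)

section \<open>Coordinates on projective space\<close>

lemma hpoint_scaleR:
  fixes x :: "'k::{real_normed_field,euclidean_space} ^ 'n::finite"
  assumes "c \<noteq> 0"
  shows "hpoint (c *\<^sub>R x) (of_real c * t) = hpoint x t"
proof -
  have "c *\<^sub>R x = of_real c *s x" by (simp add: vec_eq_iff scaleR_conv_of_real[symmetric])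
  then show ?thesis using hpoint_scale[of "of_real c" x t] assms by simp
qed

lemma hpoint_at_infinity_iff:
  fixes x :: "'k::{real_normed_field,euclidean_space} ^ 'n::finite"
  assumes "x \<noteq> 0"
  shows "hpoint x t \<in> hyperplane_at_infinity \<longleftrightarrow> t = 0"
proof (cases "t = 0")
  case True
  then show ?thesis using assms unfolding hyperplane_at_infinity_eq by blast
next
  case False
  then have "hpoint x t = hpoint (inverse t *s x) 1"
    using hpoint_scale[of "inverse t" x t] by simp
  then show ?thesis using False unfolding hyperplane_at_infinity_def by blast
qed

lemma inj_affine_param: "inj (\<lambda>x :: 'k::{real_normed_field,euclidean_space} ^ 'n::finite. hpoint x 1)"
proof (rule injI)
  fix x y :: "'k ^ 'n" assume eq: "hpoint x 1 = hpoint y 1"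
  have "(x, 1) \<in> hpoint x 1" unfolding hpoint_def by (rule range_eqI[of _ _ 1]) simp
  then show "x = y" unfolding eq by (auto simp: hpoint_def)
qed

lemma inj_proj_param: "inj (proj_param i :: 'k::{real_normed_field,euclidean_space} ^ 'n::finite \<Rightarrow> _)"
proof (rule injI)
  fix x y :: "'k ^ 'n" assume eq: "proj_param i x = proj_param i y"
  define h where "h x = (\<chi> j. if j = i then 1 else x $ j)" for x :: "'k ^ 'n"
  have "(h x, x $ i) \<in> hpoint (h x) (x $ i)" unfolding hpoint_def by (rule range_eqI[of _ _ 1]) simp
  then have "(h x, x $ i) \<in> hpoint (h y) (y $ i)" using eq by (simp add: proj_param_def h_def)
  then obtain c where c: "h x = c *s h y" "x $ i = c * y $ i" unfolding hpoint_def by auto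
  have "h x $ i = c * h y $ i" using c(1) by simp
  then have "c = 1" by (simp add: h_def)
  then have "x $ j = y $ j" for j
  proof (cases "j = i")
    case False
    have "h x $ j = h y $ j" using c(1) \<open>c = 1\<close> by simp
    then show ?thesis using False by (simp add: h_def)
  qed (use c in simp)
  then show "x = y" by (simp add: vec_eq_iff)
qed

lemma affine_chart_in_atlas: "(range (\<lambda>x. hpoint x 1), inv (\<lambda>x. hpoint x 1)) \<in> proj_atlas"
  unfolding proj_atlas_def by blast

lemma proj_chart_in_atlas: "(range (proj_param i), inv (proj_param i)) \<in> proj_atlas"
  unfolding proj_atlas_def by blast

text \<open>The coordinates of \<open>[x : t]\<close> in the chart \<open>proj_param i\<close>, in a form that is visibly smooth in \<open>(x, t)\<close>.\<close>

definition proj_coords :: "'n \<Rightarrow> 'k::{real_normed_field,euclidean_space} ^ 'n::finite \<Rightarrow> 'k \<Rightarrow> 'k ^ 'n" where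
  "proj_coords i x t = inverse (x $ i) *s (x + axis i (t - x $ i))"

lemma proj_coords_nth:
  "proj_coords i x t $ j = (if j = i then t / x $ i else x $ j / x $ i)"
  by (simp add: proj_coords_def axis_def field_simps)

lemma proj_param_coords:
  fixes x :: "'k::{real_normed_field,euclidean_space} ^ 'n::finite"
  assumes "x $ i \<noteq> 0"
  shows "proj_param i (proj_coords i x t) = hpoint x t"
proof -
  have "(\<chi> j. if j = i then 1 else proj_coords i x t $ j) = inverse (x $ i) *s x"
    using assms by (auto simp: proj_coords_nth vec_eq_iff field_simps)
  moreover have "proj_coords i x t $ i = inverse (x $ i) * t" by (simp add: proj_coords_nth field_simps)
  ultimately show ?thesis
    using hpoint_scale[of "inverse (x $ i)" x t] assms by (simp only: proj_param_def) simp
qed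

lemma proj_coords_scaleR:
  fixes x :: "'k::{real_normed_field,euclidean_space} ^ 'n::finite"
  shows "c \<noteq> 0 \<Longrightarrow> proj_coords i (c *\<^sub>R x) (of_real c * t) = proj_coords i x t"
  by (simp add: vec_eq_iff proj_coords_nth scaleR_conv_of_real[where 'a = 'k])

section \<open>From the radial compactification to projective space\<close>

text \<open>The direction of the point with coordinates \<open>v\<close> in the chart of the compactification at \<open>e\<close>, normalized
  by \<open>e \<bullet> z = 1\<close> instead of \<open>|z| = 1\<close>. It is affine in \<open>v\<close>, and homogeneous coordinates do not see the
  difference.\<close>

definition ray_through :: "'a::euclidean_space \<Rightarrow> 'a \<Rightarrow> 'a" where
  "ray_through e v = e + (v - (e \<bullet> v) *\<^sub>R e)"

lemma inner_ray_through: "norm e = 1 \<Longrightarrow> e \<bullet> ray_through e v = 1"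
  by (simp add: ray_through_def inner_simps dot_square_norm)

lemma ray_through_nonzero: "norm e = 1 \<Longrightarrow> ray_through e v \<noteq> 0"
  using inner_ray_through[of e v] by (metis inner_zero_right zero_neq_one)

fun radial_to_proj :: "('k::{real_normed_field,euclidean_space} ^ 'n::finite) radial \<Rightarrow> ('k, 'n) hline" where
  "radial_to_proj (Fin x) = hpoint x 1"
| "radial_to_proj (Bdry u) = hpoint u 0"

lemma radial_to_proj_param:
  fixes e :: "'k::{real_normed_field,euclidean_space} ^ 'n::finite"
  assumes e: "norm e = 1"
  shows "radial_to_proj (radial_param e v) = hpoint (ray_through e v) (of_real ((e \<bullet> v) * norm (ray_through e v)))"
proof -
  let ?z = "ray_through e v"
  have z: "?z \<noteq> 0" using e by (rule ray_through_nonzero)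
  have rp: "radial_param e v = radial_collar (e \<bullet> v) (?z /\<^sub>R norm ?z)"
    by (simp add: radial_param_def ray_through_def sgn_div_norm)
  show ?thesis
  proof (cases "e \<bullet> v = 0")
    case True
    then show ?thesis using z hpoint_scaleR[of "inverse (norm ?z)" ?z 0] by (simp add: rp radial_collar_def)
  next
    case False
    let ?c = "inverse ((e \<bullet> v) * norm ?z)"
    have c: "?c \<noteq> 0" using z False by simp
    have "?c * ((e \<bullet> v) * norm ?z) = 1" using z False by (intro left_inverse) simp
    then have one: "of_real ?c * of_real ((e \<bullet> v) * norm ?z) = (1::'k)"
      by (simp only: of_real_mult[symmetric] of_real_1)
    have "radial_to_proj (radial_param e v) = hpoint (?c *\<^sub>R ?z) 1"
      using False by (simp add: rp radial_collar_def mult.commute)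
    then show ?thesis using hpoint_scaleR[OF c, of ?z "of_real ((e \<bullet> v) * norm ?z)"] by (simp only: one)
  qed
qed

lemma radial_chart_in_atlas:
  "norm e = 1 \<Longrightarrow> (radial_param e ` {v. 0 \<le> e \<bullet> v}, inv_into {v. 0 \<le> e \<bullet> v} (radial_param e)) \<in> radial_atlas"
  unfolding radial_atlas_def by (intro insertI2 imageI) simp

lemma radial_atlas_cases:
  assumes "c \<in> radial_atlas"
  obtains "c = (range Fin, inv Fin)"
    | e where "norm e = 1" "c = (radial_param e ` {v. 0 \<le> e \<bullet> v}, inv_into {v. 0 \<le> e \<bullet> v} (radial_param e))"
  using assms unfolding radial_atlas_def by (auto simp: image_iff)

lemma radial_param_in_boundary_iff:
  "radial_param e v \<in> Bdry ` sphere 0 1 \<longleftrightarrow> e \<bullet> v = 0" if "norm e = 1"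
  using ray_through_nonzero[OF that, of v]
  by (auto simp: radial_param_def radial_collar_def ray_through_def norm_sgn)

lemma Ck_on_ray_through: "open S \<Longrightarrow> Ck_on k (ray_through e) S"
  unfolding ray_through_def[abs_def]
  by (intro Ck_on_add Ck_on_diff Ck_on_const Ck_on_scaleR Ck_on_inner Ck_on_ident)

lemma Ck_on_norm_ray:
  "open S \<Longrightarrow> norm e = 1 \<Longrightarrow> Ck_on k (\<lambda>v. norm (ray_through e v)) S"
  by (rule Ck_on_compose[OF _ _ Ck_on_norm Ck_on_ray_through]) (auto simp: ray_through_nonzero)

text \<open>The map \<open>radial_to_proj\<close>, read in the chart of the compactification at \<open>e\<close> and in the projective chart
  \<open>i\<close>. The formula makes sense, and is smooth, on both sides of the boundary \<open>e \<bullet> v = 0\<close>.\<close>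

definition proj_transition :: "'k::{real_normed_field,euclidean_space} ^ 'n::finite \<Rightarrow> 'n \<Rightarrow> 'k ^ 'n \<Rightarrow> 'k ^ 'n" where
  "proj_transition e i v = proj_coords i (ray_through e v) (of_real ((e \<bullet> v) * norm (ray_through e v)))"

lemma linear_axis: "linear (axis i :: 'k::real_vector \<Rightarrow> 'k ^ 'n::finite)"
  by (rule linearI) (auto simp: axis_def vec_eq_iff)

lemma bounded_bilinear_vector_scalar_mult:
  "bounded_bilinear (\<lambda>(c::'k::{real_normed_field,euclidean_space}) (x::'k ^ 'n::finite). c *s x)"
  unfolding bilinear_conv_bounded_bilinear[symmetric] bilinear_def
  by (auto intro!: linearI simp: vec_eq_iff algebra_simps)

lemma open_ray_nonzero: "open {v. ray_through (e :: 'k::{real_normed_field,euclidean_space} ^ 'n::finite) v $ i \<noteq> 0}"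
  unfolding ray_through_def by (intro open_Collect_neq continuous_intros)

lemma smooth_proj_transition:
  fixes e :: "'k::{real_normed_field,euclidean_space} ^ 'n::finite"
  assumes e: "norm e = 1"
  shows "smooth_on {v. ray_through e v $ i \<noteq> 0} (proj_transition e i)"
  unfolding smooth_on_def
proof
  fix k
  let ?D = "{v. ray_through e v $ i \<noteq> 0}"
  have D: "open ?D" by (rule open_ray_nonzero)
  have nth: "Ck_on k (\<lambda>v. ray_through e v $ i) ?D"
    using bounded_linear_vec_nth D Ck_on_ray_through[OF D] by (rule Ck_on_linear_compose)
  have t: "Ck_on k (\<lambda>v. of_real ((e \<bullet> v) * norm (ray_through e v)) :: 'k) ?D"
    by (rule Ck_on_linear_compose[OF bounded_linear_of_real D])
      (intro Ck_on_mult Ck_on_inner Ck_on_const Ck_on_ident Ck_on_norm_ray D e)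
  have "Ck_on k (\<lambda>v. axis i (of_real ((e \<bullet> v) * norm (ray_through e v)) - ray_through e v $ i)) ?D"
    by (rule Ck_on_linear_compose[OF _ D Ck_on_diff[OF D t nth]])
      (use linear_axis[where 'k = 'k] linear_conv_bounded_linear in blast)
  moreover have "Ck_on k (\<lambda>v. inverse (ray_through e v $ i)) ?D"
    by (rule Ck_on_compose[OF D _ Ck_on_inverse nth]) auto
  ultimately show "Ck_on k (proj_transition e i) ?D"
    unfolding proj_transition_def[abs_def] proj_coords_def
    by (intro Ck_on_bilinear[OF bounded_bilinear_vector_scalar_mult] Ck_on_add D Ck_on_ray_through)
qed

text \<open>Along the boundary the map is \<open>u \<mapsto> [u : 0]\<close>, and a line in the hyperplane at infinity, written as a
  curve \<open>\<zeta>\<close> of homogeneous coordinates, is lifted by rescaling \<open>\<zeta>\<close> to \<open>e \<bullet> \<zeta> = 1\<close>. A real factor is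
  enough for this, over either field.\<close>

lemma proj_transition_onto_hyperplane:
  fixes e :: "'k::{real_normed_field,euclidean_space} ^ 'n::finite"
  assumes e: "norm e = 1" and v: "e \<bullet> v = 0" "ray_through e v $ i \<noteq> 0" and d: "d $ i = 0"
  shows "\<exists>w. e \<bullet> w = 0 \<and> frechet_derivative (proj_transition e i) (at v) w = d"
proof -
  let ?D = "frechet_derivative (proj_transition e i) (at v)"
  define z where "z = ray_through e v"
  have z: "z = e + v" "e \<bullet> z = 1" "z $ i \<noteq> 0"
    using v inner_ray_through[OF e, of v] by (auto simp: z_def ray_through_def)
  \<comment> \<open>in the projective chart \<open>i\<close> the factor \<open>z $ i\<close> is divided out again, which leaves the direction \<open>d\<close>\<close>
  define \<zeta> where "\<zeta> s = z + s *\<^sub>R (z $ i *s d)" for s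
  define \<sigma> where "\<sigma> s = inverse (e \<bullet> \<zeta> s) *\<^sub>R \<zeta> s - e" for s
  define S where "S = {s. e \<bullet> \<zeta> s \<noteq> 0}"
  have S: "open S" unfolding S_def \<zeta>_def by (intro open_Collect_neq continuous_intros)
  have "0 \<in> S" using z by (simp add: S_def \<zeta>_def)
  then obtain \<delta> where \<delta>: "0 < \<delta>" "ball 0 \<delta> \<subseteq> S" using S by (meson openE)
  then have \<delta>S: "s \<in> S" if "\<bar>s\<bar> < \<delta>" for s using that by (auto simp: subset_eq dist_real_def)
  have C\<zeta>: "Ck_on (Suc 0) \<zeta> S" unfolding \<zeta>_def[abs_def] by (intro Ck_on_add Ck_on_const Ck_on_scaleR Ck_on_ident S)
  have "Ck_on (Suc 0) (\<lambda>s. inverse (e \<bullet> \<zeta> s)) S"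
    by (rule Ck_on_compose[OF S _ Ck_on_inverse Ck_on_inner[OF S Ck_on_const C\<zeta>]]) (auto simp: S_def)
  then have "Ck_on (Suc 0) \<sigma> S" unfolding \<sigma>_def[abs_def]
    by (intro Ck_on_diff Ck_on_const Ck_on_scaleR S C\<zeta>)
  then obtain w where w: "(\<sigma> has_vector_derivative w) (at 0)"
    using \<open>0 \<in> S\<close> by (rule Ck_on_has_vector_derivative)
  have e\<sigma>: "e \<bullet> \<sigma> s = 0" if "s \<in> S" for s
    using that e by (simp add: \<sigma>_def S_def inner_simps dot_square_norm)
  have ray\<sigma>: "ray_through e (\<sigma> s) = inverse (e \<bullet> \<zeta> s) *\<^sub>R \<zeta> s" if "s \<in> S" for s
    using e\<sigma>[OF that] by (simp add: ray_through_def) (simp add: \<sigma>_def)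
  have "((\<lambda>s. e \<bullet> \<sigma> s) has_vector_derivative e \<bullet> w) (at 0)"
    by (rule has_vector_derivative_chain[OF w, of "\<lambda>y. e \<bullet> y"])
      (simp add: bounded_linear_inner_right bounded_linear_imp_has_derivative)
  then have "e \<bullet> w = 0"
    by (rule right_vector_derivative_of_constant[OF _ \<delta>(1)]) (use e\<sigma> \<delta>S in auto)
  moreover have "?D w = d"
  proof (rule derivative_along_lifted_line[where x = v and \<sigma> = \<sigma> and w = w and \<delta> = \<delta> and y = "proj_coords i z 0"])
    show "(proj_transition e i has_derivative ?D) (at v)"
      by (rule smooth_on_has_derivative[OF smooth_proj_transition[OF e]]) (use v in auto)
    show "\<sigma> 0 = v" using z by (simp add: \<sigma>_def \<zeta>_def)
    show "proj_transition e i (\<sigma> s) = proj_coords i z 0 + s *\<^sub>R d" if "\<bar>s\<bar> < \<delta>" for s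
    proof -
      have s: "s \<in> S" using \<delta>S[OF that] .
      then have "inverse (e \<bullet> \<zeta> s) \<noteq> 0" by (simp add: S_def)
      from proj_coords_scaleR[OF this, of i "\<zeta> s" 0]
      have "proj_transition e i (\<sigma> s) = proj_coords i (\<zeta> s) 0"
        by (simp add: proj_transition_def e\<sigma>[OF s] ray\<sigma>[OF s])
      also have "\<dots> = proj_coords i z 0 + s *\<^sub>R d"
        using z(3) d by (simp add: vec_eq_iff proj_coords_nth \<zeta>_def field_simps)
      finally show ?thesis .
    qed
  qed (use w \<delta> in auto)
  ultimately show ?thesis by blast
qed

text \<open>The map \<open>radial_to_proj\<close>, read in the chart of the compactification at \<open>e\<close> and in the affine chart.\<close>

definition affine_transition :: "'a::euclidean_space \<Rightarrow> 'a \<Rightarrow> 'a" where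
  "affine_transition e v = inverse ((e \<bullet> v) * norm (ray_through e v)) *\<^sub>R ray_through e v"

lemma smooth_affine_transition:
  assumes e: "norm e = 1"
  shows "smooth_on {v. 0 < e \<bullet> v} (affine_transition e)"
  unfolding smooth_on_def
proof
  fix k
  let ?D = "{v. 0 < e \<bullet> v}"
  have D: "open ?D" by (rule open_halfspace_gt)
  have "Ck_on k (\<lambda>v. (e \<bullet> v) * norm (ray_through e v)) ?D"
    by (intro Ck_on_mult Ck_on_inner Ck_on_const Ck_on_ident Ck_on_norm_ray D e)
  then have "Ck_on k (\<lambda>v. inverse ((e \<bullet> v) * norm (ray_through e v))) ?D"
    by (rule Ck_on_compose[OF D _ Ck_on_inverse, rotated]) (use ray_through_nonzero[OF e] in auto)
  then show "Ck_on k (affine_transition e) ?D"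
    unfolding affine_transition_def[abs_def] by (intro Ck_on_scaleR D Ck_on_ray_through)
qed

text \<open>The inverse map is explicit: \<open>y\<close> comes from the direction \<open>y / (e \<bullet> y)\<close> at the radius \<open>r = 1 / |y|\<close>.\<close>

lemma affine_transition_submersion:
  assumes e: "norm e = 1" and v: "0 < e \<bullet> v"
  shows "\<exists>w. frechet_derivative (affine_transition e) (at v) w = d"
proof -
  let ?D = "frechet_derivative (affine_transition e) (at v)"
  define z where "z = ray_through e v"
  have z: "z = e + v - (e \<bullet> v) *\<^sub>R e" "e \<bullet> z = 1" "z \<noteq> 0"
    using inner_ray_through[OF e, of v] ray_through_nonzero[OF e, of v] by (auto simp: z_def ray_through_def)
  define y where "y s = affine_transition e v + s *\<^sub>R d" for s
  define \<sigma> where "\<sigma> s = inverse (e \<bullet> y s) *\<^sub>R y s - e + inverse (norm (y s)) *\<^sub>R e" for s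
  define S where "S = {s. 0 < e \<bullet> y s}"
  have S: "open S" unfolding S_def y_def by (intro open_Collect_less continuous_intros)
  have y0: "y 0 = inverse ((e \<bullet> v) * norm z) *\<^sub>R z" by (simp add: y_def affine_transition_def z_def)
  have "0 \<in> S" using z v by (simp add: S_def y0)
  then obtain \<delta> where \<delta>: "0 < \<delta>" "ball 0 \<delta> \<subseteq> S" using S by (meson openE)
  have ynz: "y s \<noteq> 0" if "s \<in> S" for s using that by (auto simp: S_def)
  have Cy: "Ck_on (Suc 0) y S" unfolding y_def[abs_def] by (intro Ck_on_add Ck_on_const Ck_on_scaleR Ck_on_ident S)
  have 1: "Ck_on (Suc 0) (\<lambda>s. inverse (e \<bullet> y s)) S"
    by (rule Ck_on_compose[OF S _ Ck_on_inverse Ck_on_inner[OF S Ck_on_const Cy]]) (auto simp: S_def)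
  have "Ck_on (Suc 0) (\<lambda>s. norm (y s)) S"
    by (rule Ck_on_compose[OF S _ Ck_on_norm Cy]) (use ynz in auto)
  then have 2: "Ck_on (Suc 0) (\<lambda>s. inverse (norm (y s))) S"
    by (rule Ck_on_compose[OF S _ Ck_on_inverse, rotated]) (use ynz in auto)
  have "Ck_on (Suc 0) \<sigma> S" unfolding \<sigma>_def[abs_def]
    by (intro Ck_on_add Ck_on_diff Ck_on_const Ck_on_scaleR S Cy 1 2)
  then obtain w where w: "(\<sigma> has_vector_derivative w) (at 0)"
    using \<open>0 \<in> S\<close> by (rule Ck_on_has_vector_derivative)
  have "?D w = d"
  proof (rule derivative_along_lifted_line[where x = v and \<sigma> = \<sigma> and w = w and \<delta> = \<delta> and y = "affine_transition e v"])
    show "(affine_transition e has_derivative ?D) (at v)"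
      by (rule smooth_on_has_derivative[OF smooth_affine_transition[OF e]]) (use v in auto)
    show "\<sigma> 0 = v" using z v by (simp add: \<sigma>_def y0 field_simps)
    show "affine_transition e (\<sigma> s) = affine_transition e v + s *\<^sub>R d" if "\<bar>s\<bar> < \<delta>" for s
    proof -
      have s: "s \<in> S" using that \<delta>(2) by (auto simp: subset_eq dist_real_def)
      then have ey: "0 < e \<bullet> y s" by (simp add: S_def)
      have e\<sigma>: "e \<bullet> \<sigma> s = inverse (norm (y s))"
        using ey e by (simp add: \<sigma>_def inner_simps dot_square_norm)
      then have "ray_through e (\<sigma> s) = inverse (e \<bullet> y s) *\<^sub>R y s"
        by (simp add: ray_through_def) (simp add: \<sigma>_def)
      moreover have "norm (y s) * (e \<bullet> y s * inverse (norm (y s))) * inverse (e \<bullet> y s) = 1"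
        using ey ynz[OF s] by (simp add: field_simps)
      ultimately have "affine_transition e (\<sigma> s) = y s"
        using ey by (simp add: affine_transition_def e\<sigma>)
      then show ?thesis by (simp add: y_def)
    qed
  qed (use w \<delta> in auto)
  then show ?thesis by blast
qed

lemma radial_to_proj_affine_transition:
  fixes e :: "'k::{real_normed_field,euclidean_space} ^ 'n::finite"
  assumes e: "norm e = 1" and v: "0 < e \<bullet> v"
  shows "radial_to_proj (radial_param e v) = hpoint (affine_transition e v) 1"
proof -
  have "radial_param e v = Fin (affine_transition e v)"
    using v by (simp add: radial_param_def radial_collar_def affine_transition_def ray_through_def
        sgn_div_norm mult.commute)
  then show ?thesis by simp
qed

lemma radial_to_proj_proj_transition:
  fixes e :: "'k::{real_normed_field,euclidean_space} ^ 'n::finite"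
  assumes "norm e = 1" and "ray_through e v $ i \<noteq> 0"
  shows "radial_to_proj (radial_param e v) = proj_param i (proj_transition e i v)"
  unfolding radial_to_proj_param[OF assms(1)] proj_transition_def proj_param_coords[OF assms(2)] ..

lemma ray_through_component_nonzero:
  fixes e :: "'k::{real_normed_field,euclidean_space} ^ 'n::finite"
  assumes "norm e = 1"
  obtains i where "ray_through e v $ i \<noteq> 0"
  using ray_through_nonzero[OF assms, of v] by (auto simp: vec_eq_iff)

section \<open>The preimage of a sub-manifold transverse to infinity\<close>

lemma topspace_mfd_topology: "topspace (mfd_topology A) = mfd_carrier A"
proof
  show "topspace (mfd_topology A) \<subseteq> mfd_carrier A"
    using openin_topspace[of "mfd_topology A"] unfolding openin_mfd_topology by blast
  have "openin (pullback_topology U \<phi> euclidean) (mfd_carrier A \<inter> U)" if "(U, \<phi>) \<in> A" for U \<phi>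
  proof -
    have "mfd_carrier A \<inter> U = \<phi> -` UNIV \<inter> U" using that unfolding mfd_carrier_def by auto
    then show ?thesis unfolding openin_pullback_topology by (intro exI[of _ UNIV]) simp
  qed
  then have "openin (mfd_topology A) (mfd_carrier A)" unfolding openin_mfd_topology by blast
  then show "mfd_carrier A \<subseteq> topspace (mfd_topology A)" by (rule openin_subset)
qed

locale transverse_at_infinity =
  fixes X :: "('k::{real_normed_field,euclidean_space}, 'n::finite) hline set" and k :: nat
  assumes submfd: "submanifold proj_atlas k X"
    and no_boundary: "mfd_boundary proj_atlas X = {}"
    and closed: "closedin (mfd_topology proj_atlas) X"
    and transverse: "\<And>x. x \<in> X \<inter> hyperplane_at_infinity \<Longrightarrow> transverse_at proj_atlas X hyperplane_at_infinity x"
begin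

lemma chart_preimage:
  assumes c: "(range p, inv p) \<in> proj_atlas" and p: "inj p"
  shows "euclidean_submanifold k {y. p y \<in> X}"
    and "p y \<in> X \<Longrightarrow> y \<notin> euclidean_boundary {y. p y \<in> X}"
    and "open {y. p y \<notin> X}"
proof -
  have img: "inv p ` (X \<inter> range p) = {y. p y \<in> X}" using inv_into_image_Int[OF p] by simp
  show "euclidean_submanifold k {y. p y \<in> X}"
    using submfd c unfolding submanifold_def img[symmetric] by fast
  show "y \<notin> euclidean_boundary {y. p y \<in> X}" if "p y \<in> X"
  proof
    assume "y \<in> euclidean_boundary {y. p y \<in> X}"
    then have "inv p (p y) \<in> euclidean_boundary (inv p ` (X \<inter> range p))" using p by (simp add: img)
    then have "p y \<in> mfd_boundary proj_atlas X"
      using that c unfolding mfd_boundary_def by blast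
    then show False using no_boundary by simp
  qed
  have "openin (mfd_topology proj_atlas) (topspace (mfd_topology proj_atlas) - X)"
    using closed by blast
  then have "openin (pullback_topology (range p) (inv p) euclidean) ((mfd_carrier proj_atlas - X) \<inter> range p)"
    using c unfolding openin_mfd_topology topspace_mfd_topology by auto
  then obtain V where V: "open V" "(mfd_carrier proj_atlas - X) \<inter> range p = p ` V"
    using openin_pullback_inv_into[OF p] by auto
  have "p y \<in> mfd_carrier proj_atlas" for y using c unfolding mfd_carrier_def by fast
  then have "y \<in> V \<longleftrightarrow> p y \<notin> X" for y
    using inj_image_mem_iff[OF p, of y V] unfolding V(2)[symmetric] by simp
  then have "V = {y. p y \<notin> X}" by blast
  then show "open {y. p y \<notin> X}" using V(1) by simp
qed

lemmas affine_preimage = chart_preimage[OF affine_chart_in_atlas inj_affine_param]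
lemmas proj_preimage = chart_preimage[OF proj_chart_in_atlas inj_proj_param]

lemma tangent_complement_at_infinity:
  assumes y: "proj_param i y \<in> X" "y $ i = 0"
  obtains a d where "v = a + d" "a \<in> euclidean_tangent {y. proj_param i y \<in> X} y" "d $ i = 0"
proof -
  have H: "proj_param i x \<in> hyperplane_at_infinity \<longleftrightarrow> x $ i = 0" for x :: "'k ^ 'n"
  proof -
    have "(\<chi> j. if j = i then 1 else x $ j) \<noteq> 0"
      by (metis (mono_tags, lifting) vec_lambda_beta zero_index zero_neq_one)
    then show ?thesis unfolding proj_param_def by (rule hpoint_at_infinity_iff)
  qed
  let ?c = "(range (proj_param i), inv (proj_param i)) :: ('k, 'n) hline set \<times> _"
  have inv: "inv (proj_param i) (proj_param i y) = y" by (rule inv_f_f[OF inj_proj_param])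
  have img: "inv (proj_param i) ` (S \<inter> range (proj_param i)) = {x. proj_param i x \<in> S}" for S :: "('k, 'n) hline set"
    using inv_into_image_Int[OF inj_proj_param[of i], of S] by simp
  have "proj_param i x \<in> mfd_carrier proj_atlas" for x :: "'k ^ 'n"
    unfolding mfd_carrier_def by (rule UN_I[OF proj_chart_in_atlas[of i]]) simp
  then have carrier: "{x :: 'k ^ 'n. proj_param i x \<in> mfd_carrier proj_atlas} = UNIV" by blast
  have "transverse_at proj_atlas X hyperplane_at_infinity (proj_param i y)"
    using y H by (intro transverse) simp
  then have "tangent_in ?c X (proj_param i y) + tangent_in ?c hyperplane_at_infinity (proj_param i y)
      = tangent_in ?c (mfd_carrier proj_atlas) (proj_param i y)"
    unfolding transverse_at_def using proj_chart_in_atlas[of i] by auto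
  then have "euclidean_tangent {x. proj_param i x \<in> X} y + euclidean_tangent {x. x $ i = 0} y = UNIV"
    by (simp add: tangent_in_def img inv H carrier euclidean_tangent_UNIV)
  then obtain a d where ad: "v = a + d" "a \<in> euclidean_tangent {y. proj_param i y \<in> X} y"
    "d \<in> euclidean_tangent {x. x $ i = 0} y"
    by (metis UNIV_I set_plus_elim)
  have "linear (\<lambda>x :: 'k ^ 'n. x $ i)" using bounded_linear_vec_nth linear_conv_bounded_linear by blast
  then have "d $ i = 0" using ad(3) by (rule euclidean_tangent_kernel)
  then show ?thesis using ad that by blast
qed

definition radial_preimage :: "('k ^ 'n) radial set" where
  "radial_preimage = {p \<in> mfd_carrier radial_atlas. radial_to_proj p \<in> X}"

definition radial_chart_preimage :: "'k ^ 'n \<Rightarrow> ('k ^ 'n) set" where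
  "radial_chart_preimage e = {v. 0 \<le> e \<bullet> v \<and> radial_to_proj (radial_param e v) \<in> X}"

text \<open>The hypothesis of \<open>slice_chart_pullback\<close> is met as follows. By transversality a vector \<open>t\<close> is \<open>a + d\<close> with
  \<open>a\<close> tangent to \<open>X\<close> and \<open>d\<close> tangent to the hyperplane at infinity; \<open>d\<close> lifts to a vector tangent to the
  boundary, and \<open>a\<close> is killed modulo the slice.\<close>

lemma radial_chart_preimage_boundary_chart:
  assumes e: "norm e = 1" and v: "v \<in> radial_chart_preimage e" "e \<bullet> v = 0"
  obtains U \<Phi> L b where "v \<in> U" "slice_chart U \<Phi> (radial_chart_preimage e) L b" "dim L = k"
    "\<Phi> v = 0" "\<forall>u\<in>U. e \<bullet> \<Phi> u = e \<bullet> u" "\<forall>u\<in>L. e \<bullet> u = b \<bullet> u" "b \<noteq> 0"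
proof -
  obtain i where i: "ray_through e v $ i \<noteq> 0" using e by (rule ray_through_component_nonzero)
  let ?D = "{u. ray_through e u $ i \<noteq> 0}" and ?N = "{y. proj_param i y \<in> X}"
  let ?y = "proj_transition e i v"
  have pre: "u \<in> radial_chart_preimage e \<longleftrightarrow> 0 \<le> e \<bullet> u \<and> proj_transition e i u \<in> ?N" if "u \<in> ?D" for u
    using radial_to_proj_proj_transition[OF e] that by (simp add: radial_chart_preimage_def)
  have vD: "v \<in> ?D" using i by simp
  then have y: "?y \<in> ?N" using pre v by blast
  then have "?y \<notin> euclidean_boundary ?N" using proj_preimage(2) by blast
  with proj_preimage(1) y obtain U \<Phi> L where c: "?y \<in> U" "slice_chart U \<Phi> ?N L 0" "dim L = k"
    by (rule interior_slice_chart)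
  have lin: "linear (frechet_derivative \<Phi> (at ?y))"
    using smooth_on_has_derivative[OF slice_chart_D(4)[OF c(2)] c(1)] by (rule has_derivative_linear)
  have trans: "\<exists>w. e \<bullet> w = 0 \<and>
      frechet_derivative \<Phi> (at ?y) (frechet_derivative (proj_transition e i) (at v) w - t) \<in> L" for t
  proof -
    have "?y $ i = 0" by (simp add: proj_transition_def proj_coords_nth v(2))
    with y obtain a d where ad: "t = a + d" "a \<in> euclidean_tangent ?N ?y" "d $ i = 0"
      using tangent_complement_at_infinity by (metis mem_Collect_eq)
    obtain w where w: "e \<bullet> w = 0" "frechet_derivative (proj_transition e i) (at v) w = d"
      using proj_transition_onto_hyperplane[OF e v(2) i ad(3)] by blast
    have "frechet_derivative \<Phi> (at ?y) (d - t) = - frechet_derivative \<Phi> (at ?y) a"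
      using lin ad(1) linear_neg[OF lin, of a] by simp
    moreover have "frechet_derivative \<Phi> (at ?y) a \<in> L"
      using c(2,1) ad(2) by (rule euclidean_tangent_slice)
    ultimately show ?thesis using w slice_chart_D(6)[OF c(2)] subspace_neg by metis
  qed
  obtain U' \<Phi>' L' b where c': "v \<in> U'" "U' \<subseteq> ?D"
    "slice_chart U' \<Phi>' {u \<in> ?D. proj_transition e i u \<in> ?N \<and> 0 \<le> e \<bullet> u} L' b"
    "dim L' = dim L" "\<Phi>' v = 0" "\<forall>u\<in>U'. e \<bullet> \<Phi>' u = e \<bullet> u"
    "\<forall>u\<in>L'. e \<bullet> u = b \<bullet> u" "e \<noteq> 0 \<longrightarrow> b \<noteq> 0"
    by (rule slice_chart_pullback[OF c(2) open_ray_nonzero vD smooth_proj_transition[OF e] y c(1) v(2) trans])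
  have "slice_chart U' \<Phi>' (radial_chart_preimage e) L' b"
    by (rule slice_chart_cong[OF c'(3)]) (use pre c'(2) in blast)
  moreover have "dim L' = k" using c'(4) c(3) by simp
  moreover have "b \<noteq> 0" using e c'(8) by auto
  ultimately show ?thesis by (rule that[OF c'(1) _ _ c'(5-7)])
qed

lemma radial_chart_preimage_interior_chart:
  assumes e: "norm e = 1" and v: "v \<in> radial_chart_preimage e" "0 < e \<bullet> v"
  obtains U \<Phi> L where "v \<in> U" "slice_chart U \<Phi> (radial_chart_preimage e) L 0" "dim L = k"
proof -
  let ?D = "{u. 0 < e \<bullet> u}" and ?N = "{y. hpoint y 1 \<in> X}"
  let ?y = "affine_transition e v"
  have pre: "u \<in> radial_chart_preimage e \<longleftrightarrow> affine_transition e u \<in> ?N" if "u \<in> ?D" for u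
    using radial_to_proj_affine_transition[OF e] that by (simp add: radial_chart_preimage_def)
  have vD: "v \<in> ?D" using v(2) by simp
  then have y: "?y \<in> ?N" using pre v by blast
  then have "?y \<notin> euclidean_boundary ?N" using affine_preimage(2) by blast
  with affine_preimage(1) y obtain U \<Phi> L where c: "?y \<in> U" "slice_chart U \<Phi> ?N L 0" "dim L = k"
    by (rule interior_slice_chart)
  have lin: "linear (frechet_derivative \<Phi> (at ?y))"
    using smooth_on_has_derivative[OF slice_chart_D(4)[OF c(2)] c(1)] by (rule has_derivative_linear)
  have trans: "\<exists>w. 0 \<bullet> w = 0 \<and>
      frechet_derivative \<Phi> (at ?y) (frechet_derivative (affine_transition e) (at v) w - t) \<in> L" for t
  proof -
    obtain w where "frechet_derivative (affine_transition e) (at v) w = t"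
      using affine_transition_submersion[OF e v(2)] by blast
    then show ?thesis using linear_0[OF lin] subspace_0[OF slice_chart_D(6)[OF c(2)]]
      by (intro exI[of _ w]) simp
  qed
  obtain U' \<Phi>' L' b where c': "v \<in> U'" "U' \<subseteq> ?D"
    "slice_chart U' \<Phi>' {u \<in> ?D. affine_transition e u \<in> ?N \<and> 0 \<le> 0 \<bullet> u} L' b"
    "dim L' = dim L" "\<Phi>' v = 0" "\<forall>u\<in>U'. 0 \<bullet> \<Phi>' u = 0 \<bullet> u"
    "\<forall>u\<in>L'. 0 \<bullet> u = b \<bullet> u" "(0 :: 'k ^ 'n) \<noteq> 0 \<longrightarrow> b \<noteq> 0"
    by (rule slice_chart_pullback[OF c(2) open_halfspace_gt vD smooth_affine_transition[OF e] y c(1) inner_zero_left trans])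
  have "b = 0" using c'(7) slice_chart_D(7)[OF c'(3)] by fastforce
  have "slice_chart U' \<Phi>' (radial_chart_preimage e) L' 0"
    by (rule slice_chart_cong[OF c'(3)[unfolded \<open>b = 0\<close>]]) (use pre c'(2) in auto)
  moreover have "dim L' = k" using c'(4) c(3) by simp
  ultimately show ?thesis by (rule that[OF c'(1)])
qed

text \<open>The inner normal \<open>b\<close> lies in the slice, and the segment in its direction enters the interior.
  This gives transversality to the boundary, and shows that boundary points are limits of interior ones.\<close>

lemma radial_chart_preimage_boundary_curve:
  assumes e: "norm e = 1" and v: "v \<in> radial_chart_preimage e" "e \<bullet> v = 0"
  obtains \<gamma> \<epsilon> w where "0 < \<epsilon>" "smooth_on {-\<epsilon><..<\<epsilon>} \<gamma>" "\<gamma> 0 = v" "\<gamma> ` {0..<\<epsilon>} \<subseteq> radial_chart_preimage e"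
    "\<forall>t\<in>{0<..<\<epsilon>}. 0 < e \<bullet> \<gamma> t" "(\<gamma> has_vector_derivative w) (at (0::real))" "0 < e \<bullet> w"
proof -
  obtain U \<Phi> L b where c: "v \<in> U" "slice_chart U \<Phi> (radial_chart_preimage e) L b" "dim L = k"
    "\<Phi> v = 0" "\<forall>u\<in>U. e \<bullet> \<Phi> u = e \<bullet> u" "\<forall>u\<in>L. e \<bullet> u = b \<bullet> u" "b \<noteq> 0"
    using e v by (rule radial_chart_preimage_boundary_chart)
  have b: "b \<in> L" using c(2) by (rule slice_chart_D)
  obtain \<gamma> \<epsilon> w where \<gamma>: "0 < \<epsilon>" "smooth_on {-\<epsilon><..<\<epsilon>} \<gamma>" "\<gamma> 0 = v"
    "\<forall>t\<in>{-\<epsilon><..<\<epsilon>}. \<gamma> t \<in> U \<and> \<Phi> (\<gamma> t) = \<Phi> v + t *\<^sub>R b"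
    "\<forall>t\<in>{0..<\<epsilon>}. \<gamma> t \<in> radial_chart_preimage e"
    "(\<gamma> has_vector_derivative w) (at (0::real))" "frechet_derivative \<Phi> (at v) w = b"
    using c(2) v(1) c(1) b inner_ge_zero by (rule slice_chart_curve)
  have e\<gamma>: "e \<bullet> \<gamma> t = t * (b \<bullet> b)" if "t \<in> {-\<epsilon><..<\<epsilon>}" for t
    using \<gamma>(4) c(4,5,6) b that by (metis add_0 inner_scaleR_right)
  have "((\<lambda>t. e \<bullet> \<gamma> t) has_vector_derivative e \<bullet> w) (at 0)"
    by (rule has_vector_derivative_chain[OF \<gamma>(6), of "\<lambda>y. e \<bullet> y"])
      (simp add: bounded_linear_inner_right bounded_linear_imp_has_derivative)
  moreover have "((\<lambda>t. e \<bullet> \<gamma> t) has_vector_derivative b \<bullet> b) (at 0)"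
  proof (rule has_vector_derivative_transform_within_open[of _ _ _ "{-\<epsilon><..<\<epsilon>}"])
    show "((\<lambda>t. t * (b \<bullet> b)) has_vector_derivative b \<bullet> b) (at 0)"
      by (auto intro!: derivative_eq_intros simp: has_real_derivative_iff_has_vector_derivative[symmetric])
  qed (use \<gamma>(1) e\<gamma> in auto)
  ultimately have "e \<bullet> w = b \<bullet> b" by (rule vector_derivative_unique_at)
  then have ew: "0 < e \<bullet> w" using c(7) by simp
  have "\<forall>t\<in>{0<..<\<epsilon>}. 0 < e \<bullet> \<gamma> t"
    using e\<gamma> c(7) by simp
  then show ?thesis using \<gamma>(5) ew by (intro that[OF \<gamma>(1-3) _ _ \<gamma>(6)]) auto
qed

lemma radial_chart_preimage_tangent:
  assumes e: "norm e = 1" and v: "v \<in> radial_chart_preimage e" "e \<bullet> v = 0"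
  shows "euclidean_tangent (radial_chart_preimage e) v + euclidean_tangent {u. e \<bullet> u = 0} v = UNIV"
proof -
  obtain \<gamma> \<epsilon> w where \<gamma>: "0 < \<epsilon>" "smooth_on {-\<epsilon><..<\<epsilon>} \<gamma>" "\<gamma> 0 = v" "\<gamma> ` {0..<\<epsilon>} \<subseteq> radial_chart_preimage e"
    "\<forall>t\<in>{0<..<\<epsilon>}. 0 < e \<bullet> \<gamma> t" "(\<gamma> has_vector_derivative w) (at (0::real))" "0 < e \<bullet> w"
    using e v by (rule radial_chart_preimage_boundary_curve)
  have w: "w \<in> euclidean_tangent (radial_chart_preimage e) v"
    using \<gamma>(1-4,6) by (rule euclidean_tangent_velocity)
  have "y \<in> euclidean_tangent (radial_chart_preimage e) v + euclidean_tangent {u. e \<bullet> u = 0} v" for y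
  proof -
    define c where "c = (e \<bullet> y) / (e \<bullet> w)"
    have "e \<bullet> (y - c *\<^sub>R w) = 0" using \<gamma>(7) by (simp add: c_def inner_diff_right)
    then have "y - c *\<^sub>R w \<in> euclidean_tangent {u. e \<bullet> u = 0} v"
      using v(2) by (intro euclidean_tangent_line) (simp add: inner_simps)
    moreover have "c *\<^sub>R w \<in> euclidean_tangent (radial_chart_preimage e) v"
      using w subspace_euclidean_tangent by (rule subspace_scale[rotated])
    ultimately have "c *\<^sub>R w + (y - c *\<^sub>R w)
        \<in> euclidean_tangent (radial_chart_preimage e) v + euclidean_tangent {u. e \<bullet> u = 0} v"
      by (intro set_plus_intro)
    then show ?thesis by simp
  qed
  then show ?thesis by blast
qed

lemma radial_param_carrier:
  "norm e = 1 \<Longrightarrow> 0 \<le> e \<bullet> v \<Longrightarrow> radial_param e v \<in> mfd_carrier radial_atlas"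
  unfolding mfd_carrier_def by (rule UN_I[OF radial_chart_in_atlas]) (auto intro!: imageI)

lemma radial_chart_image:
  assumes "norm e = 1"
  shows "inv_into {v. 0 \<le> e \<bullet> v} (radial_param e) ` (S \<inter> radial_param e ` {v. 0 \<le> e \<bullet> v})
    = {v. 0 \<le> e \<bullet> v \<and> radial_param e v \<in> S}"
  using inv_into_image_Int[OF radial_param_inj[of e], of S] assms by simp

lemma radial_preimage_in_radial_chart:
  assumes "norm e = 1"
  shows "inv_into {v. 0 \<le> e \<bullet> v} (radial_param e) ` (radial_preimage \<inter> radial_param e ` {v. 0 \<le> e \<bullet> v}) = radial_chart_preimage e"
  unfolding radial_chart_image[OF assms] using radial_param_carrier[OF assms]
  by (auto simp: radial_preimage_def radial_chart_preimage_def)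

lemma inv_into_radial_param:
  assumes "norm e = 1" "0 \<le> e \<bullet> v"
  shows "inv_into {v. 0 \<le> e \<bullet> v} (radial_param e) (radial_param e v) = v"
  using assms by (intro inv_into_f_f radial_param_inj) auto

lemma radial_preimage_in_affine_chart: "inv Fin ` (radial_preimage \<inter> range Fin) = {x. hpoint x 1 \<in> X}"
proof -
  have "inv Fin ` (radial_preimage \<inter> range Fin) = {x. Fin x \<in> radial_preimage}"
    using inv_into_image_Int[of Fin UNIV radial_preimage] by (simp add: inj_def)
  then show ?thesis by (auto simp: radial_preimage_def mfd_carrier_radial_atlas)
qed

lemma submanifold_radial_preimage: "submanifold radial_atlas k radial_preimage"
proof -
  have "euclidean_submanifold k (\<phi> ` (radial_preimage \<inter> U))" if c: "(U, \<phi>) \<in> radial_atlas" for U \<phi>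
    using c
  proof (cases rule: radial_atlas_cases)
    case 1
    then show ?thesis using affine_preimage(1) radial_preimage_in_affine_chart by simp
  next
    case (2 e)
    have "\<exists>U \<Phi> L b. v \<in> U \<and> slice_chart U \<Phi> (radial_chart_preimage e) L b \<and> dim L = k" if v: "v \<in> radial_chart_preimage e" for v
    proof (cases "e \<bullet> v = 0")
      case True
      with 2(1) v show ?thesis by (rule radial_chart_preimage_boundary_chart) blast
    next
      case False
      then have "0 < e \<bullet> v" using v by (simp add: radial_chart_preimage_def)
      with 2(1) v show ?thesis by (rule radial_chart_preimage_interior_chart) blast
    qed
    then have "euclidean_submanifold k (radial_chart_preimage e)" unfolding euclidean_submanifold_def by blast
    then show ?thesis using 2 radial_preimage_in_radial_chart by simp
  qed
  then show ?thesis unfolding submanifold_def radial_preimage_def by blast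
qed

text \<open>Points over the affine part have interior charts, and these exclude boundary charts; the points at
  infinity have boundary charts by construction.\<close>

lemma boundary_radial_preimage: "mfd_boundary radial_atlas radial_preimage = radial_preimage \<inter> Bdry ` sphere 0 1"
proof (intro equalityI subsetI)
  fix p assume p: "p \<in> mfd_boundary radial_atlas radial_preimage"
  then obtain U \<phi> where c: "(U, \<phi>) \<in> radial_atlas" "p \<in> U" "\<phi> p \<in> euclidean_boundary (\<phi> ` (radial_preimage \<inter> U))"
    and "p \<in> radial_preimage" unfolding mfd_boundary_def by blast
  have "p \<notin> range Fin"
  proof
    assume "p \<in> range Fin"
    then obtain x where x: "p = Fin x" by blast
    show False using c(1)
    proof (cases rule: radial_atlas_cases)
      case 1
      then have "x \<in> euclidean_boundary {x. hpoint x 1 \<in> X}"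
        using c(3) radial_preimage_in_affine_chart by (simp add: x inj_def)
      moreover have "hpoint x 1 \<in> X" using \<open>p \<in> radial_preimage\<close> by (simp add: radial_preimage_def x)
      ultimately show False using affine_preimage(2) by blast
    next
      case (2 e)
      obtain v where v: "0 \<le> e \<bullet> v" "p = radial_param e v" using c(2) 2 by auto
      have "v \<in> euclidean_boundary (radial_chart_preimage e)"
        using c(3) 2 radial_preimage_in_radial_chart[OF 2(1)] inv_into_radial_param[OF 2(1) v(1)] v(2) by simp
      moreover have vh: "v \<in> radial_chart_preimage e" using v \<open>p \<in> radial_preimage\<close> by (simp add: radial_preimage_def radial_chart_preimage_def)
      moreover have "p \<notin> Bdry ` sphere 0 1" using x by auto
      then have "0 < e \<bullet> v" using v radial_param_in_boundary_iff[OF 2(1)] by (metis less_eq_real_def)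
      with 2(1) vh obtain U \<Phi> L where "v \<in> U" "slice_chart U \<Phi> (radial_chart_preimage e) L 0" "dim L = k"
        by (rule radial_chart_preimage_interior_chart)
      ultimately show False using slice_interior_not_in_boundary by blast
    qed
  qed
  then show "p \<in> radial_preimage \<inter> Bdry ` sphere 0 1"
    using \<open>p \<in> radial_preimage\<close> by (auto simp: radial_preimage_def mfd_carrier_radial_atlas)
next
  fix p :: "('k ^ 'n) radial" assume "p \<in> radial_preimage \<inter> Bdry ` sphere 0 1"
  then obtain u where u: "norm u = 1" "p = Bdry u" "p \<in> radial_preimage" by auto
  have pu: "p = radial_param u 0"
    using u by (simp add: radial_param_def radial_collar_def sgn_div_norm)
  then have h: "0 \<in> radial_chart_preimage u" using u(3) by (simp add: radial_chart_preimage_def radial_preimage_def)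
  obtain U \<Phi> L b where "0 \<in> U" "slice_chart U \<Phi> (radial_chart_preimage u) L b" "dim L = k"
    "\<Phi> 0 = 0" "\<forall>v\<in>U. u \<bullet> \<Phi> v = u \<bullet> v" "\<forall>v\<in>L. u \<bullet> v = b \<bullet> v" "b \<noteq> 0"
    using u(1) h inner_zero_right by (rule radial_chart_preimage_boundary_chart)
  then have "0 \<in> euclidean_boundary (radial_chart_preimage u)"
    using h unfolding euclidean_boundary_def
    by (intro CollectI conjI exI[of _ U] exI[of _ \<Phi>] exI[of _ L] exI[of _ b]) simp_all
  then have "inv_into {v. 0 \<le> u \<bullet> v} (radial_param u) p
      \<in> euclidean_boundary (inv_into {v. 0 \<le> u \<bullet> v} (radial_param u) ` (radial_preimage \<inter> radial_param u ` {v. 0 \<le> u \<bullet> v}))"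
    using radial_preimage_in_radial_chart[OF u(1)] inv_into_radial_param[OF u(1), of 0] by (simp add: pu)
  moreover have "p \<in> radial_param u ` {v. 0 \<le> u \<bullet> v}" using pu by simp
  ultimately show "p \<in> mfd_boundary radial_atlas radial_preimage"
    unfolding mfd_boundary_def
    by (intro CollectI conjI u(3) bexI[OF _ radial_chart_in_atlas[OF u(1)]]) simp_all
qed

lemma transverse_radial_preimage:
  assumes p: "p \<in> radial_preimage" "p \<in> Bdry ` sphere 0 1"
  shows "transverse_at radial_atlas radial_preimage (mfd_boundary radial_atlas (mfd_carrier radial_atlas)) p"
  unfolding transverse_at_def
proof (intro ballI impI)
  fix c :: "('k ^ 'n) radial set \<times> (('k ^ 'n) radial \<Rightarrow> 'k ^ 'n)"
  assume "c \<in> radial_atlas" "p \<in> fst c"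
  then show "tangent_in c radial_preimage p + tangent_in c (mfd_boundary radial_atlas (mfd_carrier radial_atlas)) p
      = tangent_in c (mfd_carrier radial_atlas) p"
  proof (cases rule: radial_atlas_cases)
    case 1
    then show ?thesis using p \<open>p \<in> fst c\<close> by auto
  next
    case (2 e)
    let ?H = "{u. e \<bullet> u = 0}" and ?D = "{u. 0 \<le> e \<bullet> u}"
    obtain v where v: "0 \<le> e \<bullet> v" "p = radial_param e v" using \<open>p \<in> fst c\<close> 2 by auto
    have vh: "v \<in> radial_chart_preimage e" using v p by (simp add: radial_preimage_def radial_chart_preimage_def)
    have ev: "e \<bullet> v = 0" using p v radial_param_in_boundary_iff[OF 2(1)] by simp
    have T: "tangent_in c S p = euclidean_tangent {u. 0 \<le> e \<bullet> u \<and> radial_param e u \<in> S} v" for S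
      using 2 radial_chart_image[OF 2(1)] inv_into_radial_param[OF 2(1) v(1)] v(2)
      by (simp add: tangent_in_def)
    have l: "{u. 0 \<le> e \<bullet> u \<and> radial_param e u \<in> radial_preimage} = radial_chart_preimage e"
      using radial_preimage_in_radial_chart[OF 2(1)] radial_chart_image[OF 2(1)] by simp
    have H: "{u. 0 \<le> e \<bullet> u \<and> radial_param e u \<in> Bdry ` sphere 0 1} = ?H"
      using radial_param_in_boundary_iff[OF 2(1)] by auto
    have D: "{u. 0 \<le> e \<bullet> u \<and> radial_param e u \<in> mfd_carrier radial_atlas} = ?D"
      using radial_param_carrier[OF 2(1)] by auto
    have sum: "euclidean_tangent (radial_chart_preimage e) v + euclidean_tangent ?H v = UNIV"
      using 2(1) vh ev by (rule radial_chart_preimage_tangent)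
    have "y \<in> euclidean_tangent ?D v" for y
    proof -
      obtain a b where ab: "y = a + b" "a \<in> euclidean_tangent (radial_chart_preimage e) v" "b \<in> euclidean_tangent ?H v"
        using sum by (metis UNIV_I set_plus_elim)
      have "radial_chart_preimage e \<subseteq> ?D" "?H \<subseteq> ?D" by (auto simp: radial_chart_preimage_def)
      then have "a \<in> euclidean_tangent ?D v" "b \<in> euclidean_tangent ?D v"
        using ab euclidean_tangent_mono by blast+
      then show ?thesis unfolding ab(1) using subspace_euclidean_tangent by (rule subspace_add[rotated])
    qed
    then have "euclidean_tangent ?D v = UNIV" by blast
    then show ?thesis unfolding mfd_boundary_radial_atlas T l H D sum by simp
  qed
qed

lemma p_submanifold_radial_preimage: "p_submanifold radial_atlas radial_preimage"
  unfolding p_submanifold_def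
  using submanifold_radial_preimage boundary_radial_preimage transverse_radial_preimage mfd_boundary_radial_atlas[where 'a = "'k ^ 'n"]
  by auto

lemma closedin_radial_preimage: "closedin (mfd_topology radial_atlas) radial_preimage"
proof -
  have "openin (pullback_topology U \<phi> euclidean) ((mfd_carrier radial_atlas - radial_preimage) \<inter> U)"
    if "(U, \<phi>) \<in> radial_atlas" for U \<phi>
    using that
  proof (cases rule: radial_atlas_cases)
    case 1
    have inj: "inj (Fin :: 'k ^ 'n \<Rightarrow> _)" by (simp add: inj_def)
    have "(mfd_carrier radial_atlas - radial_preimage) \<inter> range Fin = Fin ` ({x. hpoint x 1 \<notin> X} \<inter> UNIV)"
      by (auto simp: radial_preimage_def mfd_carrier_radial_atlas)
    then show ?thesis using 1 openin_pullback_inv_into[OF inj] affine_preimage(3) by blast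
  next
    case (2 e)
    let ?D = "{v. 0 \<le> e \<bullet> v}"
    define V where "V = (\<Union>i. {v. ray_through e v $ i \<noteq> 0} \<inter> proj_transition e i -` {y. proj_param i y \<notin> X})"
    have "open V" unfolding V_def
      by (intro open_UN ballI continuous_open_preimage smooth_on_continuous[OF smooth_proj_transition[OF 2(1)]]
          open_ray_nonzero proj_preimage(3))
    moreover have "v \<in> V \<longleftrightarrow> radial_to_proj (radial_param e v) \<notin> X" for v
    proof -
      obtain i where i: "ray_through e v $ i \<noteq> 0" using 2(1) by (rule ray_through_component_nonzero)
      note eq = radial_to_proj_proj_transition[OF 2(1)]
      have "v \<in> V \<longleftrightarrow> (\<exists>j. ray_through e v $ j \<noteq> 0 \<and> radial_to_proj (radial_param e v) \<notin> X)"
        by (simp add: V_def eq cong: conj_cong)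
      then show ?thesis using i by blast
    qed
    then have "(mfd_carrier radial_atlas - radial_preimage) \<inter> radial_param e ` ?D = radial_param e ` (V \<inter> ?D)"
      using radial_param_carrier[OF 2(1)] by (auto simp: radial_preimage_def)
    moreover have "inj_on (radial_param e) ?D" using 2(1) by (intro radial_param_inj) simp
    ultimately show ?thesis using 2 openin_pullback_inv_into by blast
  qed
  then have "openin (mfd_topology radial_atlas) (mfd_carrier radial_atlas - radial_preimage)"
    unfolding openin_mfd_topology by blast
  then show ?thesis unfolding closedin_def topspace_mfd_topology radial_preimage_def by blast
qed

text \<open>One inclusion holds since the preimage is closed, the other one since a boundary point of the preimage
  is the end of a curve in its interior.\<close>

lemma radial_closure_affine_part: "radial_closure {x. hpoint x 1 \<in> X} = radial_preimage"
proof
  have "Fin ` {x. hpoint x 1 \<in> X} \<subseteq> radial_preimage" by (auto simp: radial_preimage_def mfd_carrier_radial_atlas)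
  then show "radial_closure {x. hpoint x 1 \<in> X} \<subseteq> radial_preimage"
    unfolding radial_closure_def using closedin_radial_preimage by (rule closure_of_minimal)
next
  show "radial_preimage \<subseteq> radial_closure {x. hpoint x 1 \<in> X}"
  proof
    fix p assume p: "p \<in> radial_preimage"
    have "\<exists>q\<in>Fin ` {x. hpoint x 1 \<in> X}. q \<in> W" if W: "openin (mfd_topology radial_atlas) W" "p \<in> W" for W
    proof (cases p)
      case (Fin x)
      then show ?thesis using p W by (auto simp: radial_preimage_def)
    next
      case (Bdry u)
      then have u: "norm u = 1" using p by (auto simp: radial_preimage_def mfd_carrier_radial_atlas)
      let ?D = "{v. 0 \<le> u \<bullet> v}"
      have pu: "p = radial_param u 0"
        using u Bdry by (simp add: radial_param_def radial_collar_def sgn_div_norm)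
      have inj: "inj_on (radial_param u) ?D" using u by (intro radial_param_inj) simp
      have "openin (pullback_topology (radial_param u ` ?D) (inv_into ?D (radial_param u)) euclidean)
          (W \<inter> radial_param u ` ?D)"
        using W(1) radial_chart_in_atlas[OF u] unfolding openin_mfd_topology by blast
      then obtain V where V: "open V" "W \<inter> radial_param u ` ?D = radial_param u ` (V \<inter> ?D)"
        using openin_pullback_inv_into[OF inj] by blast
      have "0 \<in> V"
      proof -
        have "radial_param u 0 \<in> radial_param u ` (V \<inter> ?D)" using W(2) V(2) pu by auto
        then show ?thesis using inj by (auto dest: inj_onD)
      qed
      have h: "0 \<in> radial_chart_preimage u" using pu p by (simp add: radial_chart_preimage_def radial_preimage_def)
      obtain \<gamma> \<epsilon> w where \<gamma>: "0 < \<epsilon>" "smooth_on {-\<epsilon><..<\<epsilon>} \<gamma>" "\<gamma> 0 = 0" "\<gamma> ` {0..<\<epsilon>} \<subseteq> radial_chart_preimage u"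
        "\<forall>t\<in>{0<..<\<epsilon>}. 0 < u \<bullet> \<gamma> t" "(\<gamma> has_vector_derivative w) (at (0::real))" "0 < u \<bullet> w"
        using u h inner_zero_right by (rule radial_chart_preimage_boundary_curve)
      have "isCont \<gamma> 0" using \<gamma>(6) by (rule has_vector_derivative_continuous)
      then have "\<forall>\<^sub>F t in at 0. \<gamma> t \<in> V"
        using \<gamma>(3) \<open>0 \<in> V\<close> V(1) by (auto simp: isCont_def intro: topological_tendstoD)
      then obtain \<delta> where \<delta>: "0 < \<delta>" "\<And>t. \<bar>t\<bar> < \<delta> \<Longrightarrow> t \<noteq> 0 \<Longrightarrow> \<gamma> t \<in> V"
        unfolding eventually_at by (auto simp: dist_real_def)
      define t where "t = min \<delta> \<epsilon> / 2"
      have t: "0 < t" "t < \<delta>" "t < \<epsilon>" using \<delta> \<gamma>(1) by (auto simp: t_def)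
      let ?q = "radial_param u (\<gamma> t)"
      have pos: "0 < u \<bullet> \<gamma> t" using \<gamma>(5) t by simp
      then have "?q \<in> W" using V(2) \<delta>(2)[of t] t by auto
      moreover have "?q \<in> Fin ` {x. hpoint x 1 \<in> X}"
      proof -
        have "\<gamma> t \<in> radial_chart_preimage u" using \<gamma>(4) t by auto
        then have "radial_to_proj ?q \<in> X" by (simp add: radial_chart_preimage_def)
        moreover have "?q \<in> range Fin" using pos by (simp add: radial_param_def radial_collar_def)
        ultimately show ?thesis by auto
      qed
      ultimately show ?thesis by blast
    qed
    then show "p \<in> radial_closure {x. hpoint x 1 \<in> X}"
      unfolding radial_closure_def in_closure_of topspace_mfd_topology using p by (auto simp: radial_preimage_def)
  qed
qed

lemma conic_at_infinity_affine_part: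
  assumes ne: "X \<inter> hyperplane_at_infinity \<noteq> {}"
  shows "conic_at_infinity {x. hpoint x 1 \<in> X - hyperplane_at_infinity}"
proof -
  have Y: "{x. hpoint x 1 \<in> X - hyperplane_at_infinity} = {x. hpoint x 1 \<in> X}"
    by (auto simp: hyperplane_at_infinity_def)
  let ?Y = "{x. hpoint x 1 \<in> X}"
  obtain y where y: "y \<noteq> 0" "hpoint y 0 \<in> X"
    using ne unfolding hyperplane_at_infinity_eq by auto
  define u where "u = inverse (norm y) *\<^sub>R y"
  have "hpoint u 0 \<in> X" using hpoint_scaleR[of "inverse (norm y)" y 0] y by (simp add: u_def)
  moreover have "norm u = 1" using y by (simp add: u_def)
  ultimately have "u \<in> directions_at_infinity ?Y"
    unfolding directions_at_infinity_def radial_closure_affine_part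
    by (simp add: radial_preimage_def mfd_carrier_radial_atlas)
  moreover have "openin (mfd_topology radial_atlas) (mfd_carrier radial_atlas :: ('k ^ 'n) radial set)"
    using openin_topspace[of "mfd_topology radial_atlas"] by (simp add: topspace_mfd_topology)
  moreover have "Bdry ` directions_at_infinity ?Y \<subseteq> mfd_carrier radial_atlas"
    by (auto simp: directions_at_infinity_def mfd_carrier_radial_atlas)
  ultimately show ?thesis
    unfolding Y conic_at_infinity_def radial_closure_affine_part
    using p_submanifold_radial_preimage by blast
qed

end

theorem lemma5p2:
  shows "(\<forall>(X :: (real, 'n::finite) hline set) k.
            submanifold proj_atlas k X \<and> mfd_boundary proj_atlas X = {} \<and>
            closedin (mfd_topology proj_atlas) X \<and> connectedin (mfd_topology proj_atlas) X \<and>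
            0 < k \<and> k < DIM(real ^ 'n) \<and>
            X \<inter> hyperplane_at_infinity \<noteq> {} \<and>
            (\<forall>x \<in> X \<inter> hyperplane_at_infinity. transverse_at proj_atlas X hyperplane_at_infinity x)
            \<longrightarrow> conic_at_infinity {x. hpoint x 1 \<in> X - hyperplane_at_infinity})
       \<and> (\<forall>(X :: (complex, 'n) hline set) k.
            submanifold proj_atlas k X \<and> mfd_boundary proj_atlas X = {} \<and>
            closedin (mfd_topology proj_atlas) X \<and> connectedin (mfd_topology proj_atlas) X \<and>
            0 < k \<and> k < DIM(complex ^ 'n) \<and>
            X \<inter> hyperplane_at_infinity \<noteq> {} \<and>
            (\<forall>x \<in> X \<inter> hyperplane_at_infinity. transverse_at proj_atlas X hyperplane_at_infinity x)
            \<longrightarrow> conic_at_infinity {x. hpoint x 1 \<in> X - hyperplane_at_infinity})"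
  by (intro conjI allI impI transverse_at_infinity.conic_at_infinity_affine_part
      transverse_at_infinity.intro; blast)

end
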